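(* There exists an infinite class of simple biconnected 4-regular planar graphs none of which admits a realization as a system of circles.
   Context: A realization of a simple connected 4-regular planar graph $G$ as a system of circles is a finite set of circles in the plane such that, taking as vertices all points at which two of the circles cross or touch, and as edges all circular arcs of these circles between consecutive such points, the resulting plane graph is $G$. *)

theory Defs
  imports "Graph_Theory.Digraph_Isomorphism" "HOL-Analysis.Analysis"
begin

text \<open>
  A finite simple graph is a \<^const>\<open>pair_graph\<close>: a finite, loop-free, symmetric set of pairs over
  a finite vertex set.  The two pairs \<open>(u, v)\<close> and \<open>(v, u)\<close> together stand for one undirected
  edge, which is represented below by the two-element set \<open>{u, v}\<close>.
\<close>

definition uedges :: "'a pair_pre_digraph \<Rightarrow> 'a set set" where
  "uedges G = {{u, v} |u v. (u, v) \<in> parcs G}"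

definition regular :: "nat \<Rightarrow> 'a pair_pre_digraph \<Rightarrow> bool" where
  "regular k G \<longleftrightarrow> (\<forall>v \<in> pverts G. out_degree G v = k)"

definition biconnected :: "'a pair_pre_digraph \<Rightarrow> bool" where
  "biconnected G \<longleftrightarrow> card (pverts G) \<ge> 3 \<and> Digraph_Component.connected G \<and>
     (\<forall>v \<in> pverts G. Digraph_Component.connected (pre_digraph.del_vert G v))"

definition plane_drawing ::
    "'a pair_pre_digraph \<Rightarrow> ('a \<Rightarrow> complex) \<Rightarrow> ('a set \<Rightarrow> real \<Rightarrow> complex) \<Rightarrow> bool" where
  "plane_drawing G p \<gamma> \<longleftrightarrow>
     inj_on p (pverts G) \<and>
     (\<forall>e \<in> uedges G. arc (\<gamma> e) \<and> {pathstart (\<gamma> e), pathfinish (\<gamma> e)} = p ` e \<and>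
        path_image (\<gamma> e) \<inter> p ` pverts G = p ` e) \<and>
     (\<forall>e \<in> uedges G. \<forall>f \<in> uedges G. e \<noteq> f \<longrightarrow>
        path_image (\<gamma> e) \<inter> path_image (\<gamma> f) = p ` (e \<inter> f))"

definition planar :: "'a pair_pre_digraph \<Rightarrow> bool" where
  "planar G \<longleftrightarrow> (\<exists>p \<gamma>. plane_drawing G p \<gamma>)"

definition circle_system :: "complex set set \<Rightarrow> bool" where
  "circle_system \<C> \<longleftrightarrow> finite \<C> \<and> (\<forall>c \<in> \<C>. \<exists>z r. r > 0 \<and> c = sphere z r)"

text \<open>Two distinct circles cross or touch at each of their common points.\<close>

definition system_points :: "complex set set \<Rightarrow> complex set" where
  "system_points \<C> = {x. \<exists>c \<in> \<C>. \<exists>d \<in> \<C>. c \<noteq> d \<and> x \<in> c \<and> x \<in> d}"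

text \<open>
  The arcs between consecutive points are given without their ends: they are the pieces into which
  the points cut the circles.  A circle with a single point on it yields an arc from that point to
  itself (a loop), and a circle without any such point yields no arc.
\<close>

definition system_arcs :: "complex set set \<Rightarrow> complex set set" where
  "system_arcs \<C> =
     (\<Union>c \<in> {c \<in> \<C>. c \<inter> system_points \<C> \<noteq> {}}. components (c - system_points \<C>))"

definition arc_ends :: "complex set \<Rightarrow> complex set" where
  "arc_ends a = closure a - a"

text \<open>
  The plane graph of a system may have loops and parallel edges.  Since \<open>g\<close> is a bijection on edges
  and every edge of \<open>G\<close> has two ends, it has neither if it realizes a simple graph \<open>G\<close>.
\<close>

definition realizes :: "complex set set \<Rightarrow> 'a pair_pre_digraph \<Rightarrow> bool" where
  "realizes \<C> G \<longleftrightarrow>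
     (\<exists>f g. bij_betw f (pverts G) (system_points \<C>) \<and>
            bij_betw g (uedges G) (system_arcs \<C>) \<and>
            (\<forall>e \<in> uedges G. arc_ends (g e) = f ` e))"

definition circle_realizable :: "'a pair_pre_digraph \<Rightarrow> bool" where
  "circle_realizable G \<longleftrightarrow> (\<exists>\<C>. circle_system \<C> \<and> realizes \<C> G)"

end

theory Submission
  imports Defs
begin

text \<open>
  The graphs consist of an 8-cycle \<open>X 0, \<dots>, X 7\<close> and four chords, two drawn inside and two outside the
  cycle.  Each chord joins its two ends to a middle vertex \<open>Z k\<close>, each by an edge and by a
  long strand that hangs on two edges only.

  In a realization every circle passes through a 2-edge cut an even number of times, so both ends of a
  strand lie on the same circle.  Since two circles share at most two points, this forces the edge and
  the strand from \<open>X i\<close> to its \<open>Z k\<close> to form one circle \<open>D i\<close>, and the 8-cycle to form one circle \<open>C\<close>.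
  Then \<open>D i\<close> touches \<open>C\<close> at \<open>X i\<close>, and \<open>D i\<close> meets \<open>D j\<close> exactly if \<open>i\<close> and \<open>j\<close> are the ends of a chord.

  A circle touching \<open>C\<close> at \<open>a\<close> is described by a real number \<open>T\<close>, whose sign tells inside from outside,
  and two such circles meet iff \<open>S\<^sup>2 \<le> T T'\<close>, where \<open>S\<close> is the half chord length between the points of
  contact on the unit circle.  By Ptolemy's theorem, interlaced chords lie on different sides of \<open>C\<close>.  The
  two chords on one side force a certain cross ratio of their ends to exceed 1, the other two force a
  cross ratio to exceed 1 that is at most the inverse of the first.
\<close>

section \<open>Circles touching a common circle\<close>

text \<open>A vertex of degree 4 lies on two circles, but incidences alone do not tell how its edges
  are paired. Hence the double links: parity decides where a circle that enters a strand comes out,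
  and this settles the pairing at the ends of the link too. An antiprism less one edge serves as
  strand because all its degrees are 4 except for the two loose ends; its length makes the class
  infinite. The parameter is \<open>T = \<rho> / (1 - \<rho>)\<close>, where \<rho> is the ratio of
  the homothety at the point of contact that carries \<open>C\<close> to the tangent circle. Thus
  \<open>1 / T\<close> is the signed curvature of that circle relative to \<open>C\<close>, minus 1.
  The criterion mirrors the one for circles resting on a line, which meet iff their points of
  contact are at most twice the geometric mean of the radii apart. Since each circle contributes a
  single factor, multiplying inequalities over two pairings of the same circles eliminates every
  \<open>T\<close>; what remains compares products of chord lengths, that is, a cross ratio with
  1.\<close>

lemma ptolemy_sin:
  fixes a b c d :: real
  shows "sin (c - a) * sin (d - b) = sin (b - a) * sin (d - c) + sin (d - a) * sin (c - b)"
  by (simp add: sin_diff algebra_simps)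

lemma spheres_meet_iff:
  fixes z w :: complex
  assumes "r \<ge> 0" "s \<ge> 0"
  shows "sphere z r \<inter> sphere w s \<noteq> {} \<longleftrightarrow> \<bar>r - s\<bar> \<le> dist z w \<and> dist z w \<le> r + s"
proof
  assume "sphere z r \<inter> sphere w s \<noteq> {}"
  then obtain x where "x \<in> sphere z r" "x \<in> sphere w s" by blast
  then have "dist z x = r" "dist w x = s" by auto
  then show "\<bar>r - s\<bar> \<le> dist z w \<and> dist z w \<le> r + s"
    using dist_triangle[of z x w] dist_triangle[of w x z] dist_triangle[of z w x]
    by (auto simp: dist_commute)
next
  assume d: "\<bar>r - s\<bar> \<le> dist z w \<and> dist z w \<le> r + s"
  show "sphere z r \<inter> sphere w s \<noteq> {}"
  proof (cases "z = w")
    case True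
    then have "z + of_real r \<in> sphere z r \<inter> sphere w s"
      using d assms by (auto simp: dist_norm)
    then show ?thesis by blast
  next
    case False
    define \<delta> where "\<delta> = dist z w"
    define u where "u = (w - z) / of_real \<delta>"
    \<comment> \<open>In the frame with origin \<open>z\<close> and first axis towards
      \<open>w\<close>, \<open>a\<close> is the position of the radical axis, and \<open>h\<close>
      completes a right triangle with hypotenuse \<open>r\<close>.\<close>
    define a where "a = (\<delta>\<^sup>2 + r\<^sup>2 - s\<^sup>2) / (2 * \<delta>)"
    define h where "h = sqrt (r\<^sup>2 - a\<^sup>2)"
    have pos: "\<delta> > 0" using False by (simp add: \<delta>_def)
    have u: "norm u = 1" "w = z + u * of_real \<delta>"
      using pos by (auto simp: u_def norm_divide \<delta>_def dist_norm norm_minus_commute)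
    have "(\<delta> - r)\<^sup>2 \<le> s\<^sup>2" "s\<^sup>2 \<le> (\<delta> + r)\<^sup>2"
      using d assms pos by (auto simp: abs_le_square_iff[symmetric] \<delta>_def)
    then have "\<bar>\<delta>\<^sup>2 + r\<^sup>2 - s\<^sup>2\<bar> \<le> r * (2 * \<delta>)"
      by (auto simp: power2_eq_square algebra_simps abs_le_iff)
    then have "\<bar>a\<bar> \<le> r" using pos by (simp add: a_def abs_divide pos_divide_le_eq)
    then have "a\<^sup>2 \<le> r\<^sup>2" using assms by (simp add: abs_le_square_iff[symmetric])
    then have h: "h\<^sup>2 = r\<^sup>2 - a\<^sup>2" by (simp add: h_def)
    have a: "2 * a * \<delta> = \<delta>\<^sup>2 + r\<^sup>2 - s\<^sup>2" using pos by (simp add: a_def)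
    have "z + u * Complex a h \<in> sphere z r"
      using u h assms by (simp add: dist_norm norm_mult complex_norm)
    moreover have "z + u * Complex a h - w = u * Complex (a - \<delta>) h"
      by (simp add: u(2) algebra_simps complex_eq_iff)
    then have "norm (z + u * Complex a h - w) = sqrt ((a - \<delta>)\<^sup>2 + h\<^sup>2)"
      using u by (simp add: norm_mult complex_norm)
    moreover have "(a - \<delta>)\<^sup>2 + h\<^sup>2 = s\<^sup>2"
      using a h by (simp add: power2_eq_square algebra_simps)
    ultimately have "z + u * Complex a h \<in> sphere z r \<inter> sphere w s"
      using assms by (simp add: dist_norm norm_minus_commute)
    then show ?thesis by blast
  qed
qed

text \<open>The common point equals its mirror image in the line through the two centres.\<close>
lemma tangent_circle_param:
  fixes z w a :: complex
  assumes "R > 0" "r > 0" and eq: "sphere z R \<inter> sphere w r = {a}"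
  obtains \<rho> :: real where "\<rho> \<noteq> 0" "\<rho> \<noteq> 1" "w = z + of_real (1 - \<rho>) * (a - z)" "r = \<bar>\<rho>\<bar> * R"
proof -
  define u v where "u = w - z" and "v = a - z"
  have a: "dist z a = R" "dist w a = r" using eq by auto
  then have v: "norm v = R" "norm (v - u) = r"
    by (auto simp: v_def u_def dist_norm norm_minus_commute)
  \<comment> \<open>Concentric circles with a common point coincide, so the antipode of the contact
    point would be a second common point.\<close>
  have "u \<noteq> 0"
  proof
    assume "u = 0"
    then have "z - v \<in> sphere z R \<inter> sphere w r" using v by (auto simp: u_def dist_norm)
    then have "a = z - v" unfolding eq by simp
    then show False using v \<open>R > 0\<close> by (auto simp: v_def)
  qed
  define v' where "v' = u * cnj (v / u)"
  have v': "norm v' = R" using v \<open>u \<noteq> 0\<close> by (simp add: v'_def norm_mult norm_divide)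
  have "v' - u = u * cnj (v / u - 1)" by (simp add: v'_def algebra_simps)
  then have "norm (v' - u) = norm u * norm (v / u - 1)" by (simp only: norm_mult complex_mod_cnj)
  also have "\<dots> = norm (v - u)"
    using \<open>u \<noteq> 0\<close> by (simp add: norm_mult[symmetric] algebra_simps)
  finally have "norm (v' - u) = r" using v by simp
  then have "z + v' \<in> sphere z R \<inter> sphere w r"
    using v' by (simp add: u_def dist_norm algebra_simps norm_minus_commute)
  then have "v' = v" using eq by (auto simp: v_def algebra_simps)
  then have "cnj (v / u) = v / u" using \<open>u \<noteq> 0\<close> by (simp add: v'_def field_simps)
  then obtain \<kappa> where \<kappa>: "v / u = of_real \<kappa>" by (metis Reals_cnj_iff Reals_cases)
  have "\<kappa> \<noteq> 0" using \<kappa> v \<open>R > 0\<close> \<open>u \<noteq> 0\<close> by auto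
  then have u: "u = of_real (1 / \<kappa>) * v" using \<kappa> \<open>u \<noteq> 0\<close> by (auto simp: field_simps)
  have "v - u = of_real (1 - 1 / \<kappa>) * v" by (simp add: u algebra_simps)
  then have r: "r = \<bar>1 - 1 / \<kappa>\<bar> * R" using v by (metis norm_mult norm_of_real)
  \<comment> \<open>\<open>1 - 1 / \<kappa>\<close> is the ratio of the homothety with centre
    \<open>a\<close> that carries \<open>sphere z R\<close> to \<open>sphere w r\<close>: between 0
    and 1 for a circle inside, above 1 for an enclosing one, negative for one outside.\<close>
  show thesis
  proof (rule that[of "1 - 1 / \<kappa>"])
    show "1 - 1 / \<kappa> \<noteq> 0" using r \<open>r > 0\<close> by auto
    show "w = z + of_real (1 - (1 - 1 / \<kappa>)) * (a - z)"
      using u by (simp add: u_def v_def algebra_simps)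
  qed (use r \<open>\<kappa> \<noteq> 0\<close> in auto)
qed

lemma dist_scaled_circle_points:
  fixes z :: complex
  shows "(dist (z + of_real p * (of_real R * cis \<alpha>)) (z + of_real q * (of_real R * cis \<beta>)))\<^sup>2 =
    R\<^sup>2 * ((p - q)\<^sup>2 + 4 * p * q * (sin ((\<alpha> - \<beta>) / 2))\<^sup>2)"
proof -
  have half: "2 * (sin ((\<alpha> - \<beta>) / 2))\<^sup>2 = 1 - (cos \<alpha> * cos \<beta> + sin \<alpha> * sin \<beta>)"
    using cos_double_sin[of "(\<alpha> - \<beta>) / 2"] cos_diff[of \<alpha> \<beta>] by (simp add: diff_divide_distrib)
  have "(dist (z + of_real p * (of_real R * cis \<alpha>)) (z + of_real q * (of_real R * cis \<beta>)))\<^sup>2 =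
    (p * R * cos \<alpha> - q * R * cos \<beta>)\<^sup>2 + (p * R * sin \<alpha> - q * R * sin \<beta>)\<^sup>2"
    by (simp add: dist_norm cmod_power2 mult.assoc)
  also have "\<dots> = R\<^sup>2 * (p\<^sup>2 * ((sin \<alpha>)\<^sup>2 + (cos \<alpha>)\<^sup>2) + q\<^sup>2 * ((sin \<beta>)\<^sup>2 + (cos \<beta>)\<^sup>2)
      - 2 * p * q * (cos \<alpha> * cos \<beta> + sin \<alpha> * sin \<beta>))"
    by algebra
  also have "\<dots> = R\<^sup>2 * ((p - q)\<^sup>2 + 2 * p * q * (1 - (cos \<alpha> * cos \<beta> + sin \<alpha> * sin \<beta>)))"
    unfolding sin_cos_squared_add by (simp add: power2_eq_square algebra_simps)
  finally show ?thesis by (simp add: half[symmetric])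
qed

text \<open>Squaring the conditions on the sum and the difference of the radii gives two bounds that
  together say \<open>\<bar>2 * q * S - \<rho> * \<sigma>\<bar> \<le> \<bar>\<rho> *
  \<sigma>\<bar>\<close>. A second squaring removes the absolute values, and with them the
  distinction between inner and outer contact; division by the positive
  \<open>4 * q\<^sup>2 * S\<close> leaves the claim.\<close>

lemma tangent_circles_meet_iff:
  fixes z :: complex
  assumes "R > 0" "\<rho> \<noteq> 0" "\<rho> \<noteq> 1" "\<sigma> \<noteq> 0" "\<sigma> \<noteq> 1" "sin ((\<alpha> - \<beta>) / 2) \<noteq> 0"
  shows "sphere (z + of_real (1 - \<rho>) * (of_real R * cis \<alpha>)) (\<bar>\<rho>\<bar> * R) \<inter>
      sphere (z + of_real (1 - \<sigma>) * (of_real R * cis \<beta>)) (\<bar>\<sigma>\<bar> * R) \<noteq> {} \<longleftrightarrow>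
    (sin ((\<alpha> - \<beta>) / 2))\<^sup>2 \<le> (\<rho> / (1 - \<rho>)) * (\<sigma> / (1 - \<sigma>))" (is "?meet \<longleftrightarrow> ?R")
proof -
  define d where "d = dist (z + of_real (1 - \<rho>) * (of_real R * cis \<alpha>))
    (z + of_real (1 - \<sigma>) * (of_real R * cis \<beta>))"
  define S q where "S = (sin ((\<alpha> - \<beta>) / 2))\<^sup>2" and "q = (1 - \<rho>) * (1 - \<sigma>)"
  have S: "S > 0" "q \<noteq> 0" using assms by (auto simp: S_def q_def)
  have d2: "d\<^sup>2 = R\<^sup>2 * ((\<rho> - \<sigma>)\<^sup>2 + 4 * q * S)"
    unfolding d_def dist_scaled_circle_points S_def q_def
    by (simp add: mult.assoc power2_commute)
  have pq: "\<bar>\<rho>\<bar>\<^sup>2 = \<rho>\<^sup>2" "\<bar>\<sigma>\<bar>\<^sup>2 = \<sigma>\<^sup>2" by auto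
  have "?meet \<longleftrightarrow> \<bar>\<bar>\<rho>\<bar> * R - \<bar>\<sigma>\<bar> * R\<bar> \<le> d \<and> d \<le> \<bar>\<rho>\<bar> * R + \<bar>\<sigma>\<bar> * R"
    using assms by (simp add: spheres_meet_iff d_def)
  also have "\<dots> \<longleftrightarrow> (\<bar>\<rho>\<bar> * R - \<bar>\<sigma>\<bar> * R)\<^sup>2 \<le> d\<^sup>2 \<and> d\<^sup>2 \<le> (\<bar>\<rho>\<bar> * R + \<bar>\<sigma>\<bar> * R)\<^sup>2"
    using assms by (simp add: abs_le_square_iff[symmetric] d_def)
  also have "\<dots> \<longleftrightarrow> R\<^sup>2 * (\<bar>\<rho>\<bar> - \<bar>\<sigma>\<bar>)\<^sup>2 \<le> R\<^sup>2 * ((\<rho> - \<sigma>)\<^sup>2 + 4 * q * S) \<and>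
      R\<^sup>2 * ((\<rho> - \<sigma>)\<^sup>2 + 4 * q * S) \<le> R\<^sup>2 * (\<bar>\<rho>\<bar> + \<bar>\<sigma>\<bar>)\<^sup>2"
    unfolding d2 by (simp add: power2_eq_square algebra_simps)
  also have "\<dots> \<longleftrightarrow> (\<bar>\<rho>\<bar> - \<bar>\<sigma>\<bar>)\<^sup>2 \<le> (\<rho> - \<sigma>)\<^sup>2 + 4 * q * S \<and>
      (\<rho> - \<sigma>)\<^sup>2 + 4 * q * S \<le> (\<bar>\<rho>\<bar> + \<bar>\<sigma>\<bar>)\<^sup>2"
    using assms by simp
  also have "\<dots> \<longleftrightarrow> \<bar>2 * q * S - \<rho> * \<sigma>\<bar> \<le> \<bar>\<rho> * \<sigma>\<bar>"
    unfolding power2_diff power2_sum pq abs_le_iff[of "2 * q * S - \<rho> * \<sigma>"] abs_mult by linarith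
  also have "\<dots> \<longleftrightarrow> (2 * q * S - \<rho> * \<sigma>)\<^sup>2 \<le> (\<rho> * \<sigma>)\<^sup>2"
    by (simp add: abs_le_square_iff)
  also have "\<dots> \<longleftrightarrow> 4 * (q\<^sup>2 * S) * S \<le> 4 * (q\<^sup>2 * S) * (\<rho> * \<sigma> / q)"
    using S by (simp add: power2_eq_square algebra_simps)
  also have "\<dots> \<longleftrightarrow> S \<le> \<rho> * \<sigma> / q" using S by (subst mult_le_cancel_left_pos) auto
  finally show ?thesis by (simp add: S_def q_def)
qed

section \<open>Inconsistency of the contact and separation inequalities\<close>

lemma octet_inequalities_inconsistent:
  fixes S :: "nat \<Rightarrow> nat \<Rightarrow> real" and T :: "nat \<Rightarrow> real"
  assumes pos: "\<And>i j. i < j \<Longrightarrow> j < 8 \<Longrightarrow> S i j > 0"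
    and ptolemy: "\<And>i j k l. i < j \<Longrightarrow> j < k \<Longrightarrow> k < l \<Longrightarrow> l < 8 \<Longrightarrow>
      S i k * S j l = S i j * S k l + S i l * S j k"
    and meet: "\<And>i j. (i, j) \<in> {(1, 4), (3, 6), (0, 5), (2, 7)} \<Longrightarrow> (S i j)\<^sup>2 \<le> T i * T j"
    and apart: "\<And>i j. i < j \<Longrightarrow> j < 8 \<Longrightarrow> (i, j) \<notin> {(1, 4), (3, 6), (0, 5), (2, 7)} \<Longrightarrow>
      T i * T j < (S i j)\<^sup>2"
  shows False
proof -
  define M :: "(nat \<times> nat) set" where "M = {(1, 4), (3, 6), (0, 5), (2, 7)}"
  note meet = meet[folded M_def] and apart = apart[folded M_def]
  have M: "i < 8" "j < 8" "i < j" if "(i, j) \<in> M" for i j using that by (auto simp: M_def)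
  \<comment> \<open>The same four factors \<open>T\<close> occur whether the circles are paired
    along two chords or into two separated pairs; comparing both products eliminates
    \<open>T\<close> and leaves chord lengths only.\<close>
  have less: "S i k * S j l < S i' j' * S k' l'"
    if ik: "(i, k) \<in> M" and jl: "(j, l) \<in> M"
      and ij: "i' < j'" "j' < 8" "(i', j') \<notin> M" and kl: "k' < l'" "l' < 8" "(k', l') \<notin> M"
      and T: "(T i * T k) * (T j * T l) = (T i' * T j') * (T k' * T l')" "T i' * T j' > 0" "T k' * T l' > 0"
    for i k j l i' j' k' l'
  proof -
    have "(S i k * S j l)\<^sup>2 = (S i k)\<^sup>2 * (S j l)\<^sup>2" by (simp add: power_mult_distrib)
    also have "\<dots> \<le> (T i * T k) * (T j * T l)"
      by (rule mult_mono[OF meet[OF ik] meet[OF jl] order_trans[OF zero_le_power2 meet[OF ik]]]) simp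
    also have "\<dots> < (S i' j')\<^sup>2 * (S k' l')\<^sup>2"
      unfolding T(1) using T(2,3) apart[OF ij] apart[OF kl] by (intro mult_strict_mono) auto
    also have "\<dots> = (S i' j' * S k' l')\<^sup>2" by (simp add: power_mult_distrib)
    finally show ?thesis
      by (rule power2_less_imp_less) (use pos[OF ij(1,2)] pos[OF kl(1,2)] in simp)
  qed
  have sgn: "T i * T j > 0" if "(i, j) \<in> M" for i j
  proof -
    have "0 < (S i j)\<^sup>2" using pos[of i j] M[OF that] by simp
    also note meet[OF that]
    finally show ?thesis .
  qed
  have opp: "T i * T j < 0"
    if ik: "(i, k) \<in> M" and jl: "(j, l) \<in> M" and o: "i < j" "j < k" "k < l" "(i, j) \<notin> M" "(k, l) \<notin> M" for i j k l
  proof (rule ccontr)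
    assume "\<not> T i * T j < 0"
    then have "T i * T j > 0" "T k * T l > 0"
      using sgn[OF ik] sgn[OF jl] by (auto simp: zero_less_mult_iff mult_less_0_iff)
    \<comment> \<open>Were the interlaced chords on one side, the product of the diagonals of
      \<open>i, j, k, l\<close> would be less than a product of opposite sides, against
      Ptolemy.\<close>
    then have "S i k * S j l < S i j * S k l"
      using o M[OF ik] M[OF jl] by (intro less[OF ik jl]) auto
    moreover have "S i l * S j k > 0" using pos[of i l] pos[of j k] o M[OF jl] by simp
    ultimately show False using ptolemy[of i j k l] o M[OF jl] by simp
  qed
  have "T 1 * T 3 < 0" "T 1 * T 2 < 0" "T 0 * T 3 < 0" "T 0 * T 2 < 0"
    by (rule opp[of 1 4 3 6] opp[of 1 4 2 7] opp[of 0 5 3 6] opp[of 0 5 2 7]; simp add: M_def)+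
  moreover have "T 1 * T 4 > 0" "T 0 * T 5 > 0" "T 3 * T 6 > 0" "T 2 * T 7 > 0"
    by (rule sgn; simp add: M_def)+
  ultimately have T: "T 0 * T 1 > 0" "T 4 * T 5 > 0" "T 2 * T 3 > 0" "T 6 * T 7 > 0"
    by (auto simp: zero_less_mult_iff mult_less_0_iff)
  \<comment> \<open>For two chords on one side the products compared are the two pairs of opposite
    sides of a quadrilateral. Ptolemy alone does not exclude this; it bounds a cross ratio.\<close>
  have A: "S 1 4 * S 0 5 < S 0 1 * S 4 5" by (rule less) (use T in \<open>simp_all add: M_def\<close>)
  have B: "S 3 6 * S 2 7 < S 2 3 * S 6 7" by (rule less) (use T in \<open>simp_all add: M_def\<close>)
  \<comment> \<open>Opposite sides against diagonals. Each of the four uses below moves one point: 2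
    to 1, 3 to 4, 6 to 5, 7 to 0. The factor \<open>S 1 7 * S 1 3 * S 4 6 * S 5 7\<close> collects
    the intermediate lengths, so that nothing has to be divided.\<close>
  have mono: "S i l * S j k \<le> S i k * S j l" "S i j * S k l \<le> S i k * S j l"
    if "i < j" "j < k" "k < l" "l < 8" for i j k l
    using ptolemy[OF that] pos[of i j] pos[of k l] pos[of i l] pos[of j k] that
    by (auto simp: less_imp_le)
  note p = pos[THEN less_imp_le]
  \<comment> \<open>The cross ratio only grows when the arcs (2,3) and (6,7) are widened to (1,4) and (5,0).\<close>
  have "(S 2 3 * S 6 7) * (S 1 7 * S 1 3 * S 4 6 * S 5 7) * (S 0 1 * S 4 5)
      = (S 1 7 * S 2 3) * (S 1 3 * S 4 6) * (S 4 5 * S 6 7) * (S 0 1 * S 5 7)"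
    by (simp add: mult_ac)
  also have "\<dots> \<le> (S 1 3 * S 2 7) * (S 1 4 * S 3 6) * (S 4 6 * S 5 7) * (S 0 5 * S 1 7)"
    by (rule mult_mono[OF mult_mono[OF mult_mono[OF mono(1) mono(2)] mono(2)] mono(2)])
      (simp_all add: p)
  also have "\<dots> = (S 3 6 * S 2 7) * (S 1 7 * S 1 3 * S 4 6 * S 5 7) * (S 1 4 * S 0 5)"
    by (simp add: mult_ac)
  also have "\<dots> < (S 2 3 * S 6 7) * (S 1 7 * S 1 3 * S 4 6 * S 5 7) * (S 0 1 * S 4 5)"
    by (rule mult_strict_mono[OF mult_strict_right_mono[OF B] A]) (simp_all add: p pos)
  finally show False by simp
qed

text \<open>\<epsilon> records the sense in which the contact points run round the circle:
  multiplied by it the angles increase, which makes all \<open>S i j\<close> positive. These are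
  sines of half angular differences, so \<open>ptolemy_sin\<close> is applied to half
  angles.\<close>

lemma no_tangent_octet:
  fixes z :: complex and t :: "nat \<Rightarrow> real" and D :: "nat \<Rightarrow> complex set"
  assumes "R > 0" and circle: "\<And>i. i < 8 \<Longrightarrow> \<exists>w r. r > 0 \<and> D i = sphere w r"
    and tangent: "\<And>i. i < 8 \<Longrightarrow> sphere z R \<inter> D i = {z + of_real R * cis (t i)}"
    and \<epsilon>: "\<epsilon>\<^sup>2 = 1" and order: "\<And>i j. i < j \<Longrightarrow> j < 8 \<Longrightarrow> \<epsilon> * t i < \<epsilon> * t j \<and> \<epsilon> * t j < \<epsilon> * t i + 2 * pi"
    and meet: "\<And>i j. (i, j) \<in> {(1, 4), (3, 6), (0, 5), (2, 7)} \<Longrightarrow> D i \<inter> D j \<noteq> {}"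
    and apart: "\<And>i j. i < j \<Longrightarrow> j < 8 \<Longrightarrow> (i, j) \<notin> {(1, 4), (3, 6), (0, 5), (2, 7)} \<Longrightarrow> D i \<inter> D j = {}"
  shows False
proof -
  have "\<exists>\<rho>. \<rho> \<noteq> 0 \<and> \<rho> \<noteq> 1 \<and> D i = sphere (z + of_real (1 - \<rho>) * (of_real R * cis (t i))) (\<bar>\<rho>\<bar> * R)"
    if i: "i < 8" for i
  proof -
    obtain w r where D: "r > 0" "D i = sphere w r" using circle[OF i] by auto
    obtain \<rho> where "\<rho> \<noteq> 0" "\<rho> \<noteq> 1" "w = z + of_real (1 - \<rho>) * (z + of_real R * cis (t i) - z)" "r = \<bar>\<rho>\<bar> * R"
      using tangent_circle_param[OF \<open>R > 0\<close> D(1) tangent[OF i, unfolded D]] by metis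
    then show ?thesis using D by auto
  qed
  then obtain \<rho> where \<rho>: "\<And>i. i < 8 \<Longrightarrow> \<rho> i \<noteq> 0" "\<And>i. i < 8 \<Longrightarrow> \<rho> i \<noteq> 1"
    "\<And>i. i < 8 \<Longrightarrow> D i = sphere (z + of_real (1 - \<rho> i) * (of_real R * cis (t i))) (\<bar>\<rho> i\<bar> * R)"
    by metis
  define S where "S i j = sin ((\<epsilon> * t j - \<epsilon> * t i) / 2)" for i j
  define T where "T i = \<rho> i / (1 - \<rho> i)" for i
  have pos: "S i j > 0" if "i < j" "j < 8" for i j
    using order[OF that] unfolding S_def by (intro sin_gt_zero) auto
  have "\<epsilon> = 1 \<or> \<epsilon> = -1" using \<epsilon> by (simp add: power2_eq_1_iff)
  then have sq: "(sin ((t i - t j) / 2))\<^sup>2 = (S i j)\<^sup>2" for i j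
    using sin_minus[of "(t i - t j) / 2"]
    by (auto simp: S_def minus_divide_left simp del: sin_minus)
  have iff: "D i \<inter> D j \<noteq> {} \<longleftrightarrow> (S i j)\<^sup>2 \<le> T i * T j" if "i < j" "j < 8" for i j
  proof -
    have i: "i < 8" using that by simp
    have "(sin ((t i - t j) / 2))\<^sup>2 \<noteq> 0" using sq[of i j] pos[OF that] by simp
    then show ?thesis
      unfolding \<rho>(3)[OF i] \<rho>(3)[OF that(2)] T_def sq[symmetric]
      using \<rho>(1,2)[OF i] \<rho>(1,2)[OF that(2)] \<open>R > 0\<close>
      by (intro tangent_circles_meet_iff) auto
  qed
  show False
  proof (rule octet_inequalities_inconsistent[of S T])
    fix i j k l :: nat assume "i < j" "j < k" "k < l" "l < 8"
    show "S i k * S j l = S i j * S k l + S i l * S j k"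
      using ptolemy_sin[of "\<epsilon> * t k / 2" "\<epsilon> * t i / 2" "\<epsilon> * t l / 2" "\<epsilon> * t j / 2"]
      by (simp add: S_def diff_divide_distrib)
  next
    fix i j :: nat assume M: "(i, j) \<in> {(1, 4), (3, 6), (0, 5), (2, 7)}"
    then show "(S i j)\<^sup>2 \<le> T i * T j" using meet[OF M] iff[of i j] by auto
  next
    fix i j :: nat assume ij: "i < j" "j < 8" and "(i, j) \<notin> {(1, 4), (3, 6), (0, 5), (2, 7)}"
    then show "T i * T j < (S i j)\<^sup>2" using apart[of i j] iff[OF ij] by simp
  qed (use pos in auto)
qed

section \<open>Arcs of a circle\<close>

text \<open>The complement of a piece is a finite union of closed pieces, so every piece is clopen,
  and a connected set containing it cannot be larger.\<close>

lemma components_finite_closed_partition: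
  assumes "finite A" "\<Union>A = S" and disj: "pairwise disjnt A"
    and A: "\<And>X. X \<in> A \<Longrightarrow> Topological_Spaces.connected X \<and> X \<noteq> {} \<and> closedin (top_of_set S) X"
  shows "components S = A"
proof -
  have comp: "X \<in> components S" if X: "X \<in> A" for X
  proof -
    have "S - X = \<Union>(A - {X})" using disj X \<open>\<Union>A = S\<close> by (auto simp: pairwise_def disjnt_def)
    also have "closedin (top_of_set S) \<dots>" using A \<open>finite A\<close> by (intro closedin_Union) auto
    finally have op: "openin (top_of_set S) X"
      using A[OF X] closedin_subset by (force simp: openin_closedin_eq)
    have "d = X" if d: "X \<subseteq> d" "d \<subseteq> S" "Topological_Spaces.connected d" for d
    proof -
      have "openin (top_of_set d) X" "closedin (top_of_set d) X"
        using op A[OF X] d by (auto intro: openin_subset_trans closedin_subset_trans)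
      then show ?thesis using d A[OF X] by (auto simp: connected_clopen)
    qed
    then show ?thesis using A[OF X] X \<open>\<Union>A = S\<close> by (auto simp: in_components_maximal)
  qed
  have "K \<in> A" if K: "K \<in> components S" for K
  proof -
    obtain x where "x \<in> K" using in_components_nonempty[OF K] by auto
    moreover have "K \<subseteq> S" using in_components_subset[OF K] .
    ultimately obtain X where X: "X \<in> A" "x \<in> X" using \<open>\<Union>A = S\<close> by auto
    then have "K = X" using components_nonoverlap[OF K comp[OF X(1)]] \<open>x \<in> K\<close> by auto
    then show ?thesis using X by simp
  qed
  with comp show ?thesis by blast
qed

lemma cis_inj:
  assumes "cis s = cis t" "\<bar>s - t\<bar> < 2 * pi"
  shows "s = t"
proof -
  have "sin s = sin t \<and> cos s = cos t" using assms(1) by (simp add: complex_eq_iff)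
  then obtain n :: int where n: "s = t + 2 * pi * of_int n" using sin_cos_eq_iff by blast
  then have "\<bar>of_int n :: real\<bar> < 1" using assms(2) by (simp add: abs_mult)
  then have "n = 0" by linarith
  then show ?thesis using n by simp
qed

definition on_circle :: "complex \<Rightarrow> real \<Rightarrow> real \<Rightarrow> complex" where
  "on_circle z r t = z + of_real r * cis t"

lemma on_circle_in_sphere: "r > 0 \<Longrightarrow> on_circle z r t \<in> sphere z r"
  by (simp add: on_circle_def dist_norm norm_mult)

lemma on_circle_inj:
  assumes "r > 0" "on_circle z r s = on_circle z r t" "\<bar>s - t\<bar> < 2 * pi"
  shows "s = t"
  using assms cis_inj by (auto simp: on_circle_def)

lemma on_circle_2pi: "on_circle z r (t + 2 * pi) = on_circle z r t"
  by (simp add: on_circle_def flip: cis_mult)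

lemma continuous_on_circle: "continuous_on A (on_circle z r)"
  unfolding on_circle_def cis_conv_exp by (intro continuous_intros)

lemma sphere_on_circle:
  assumes "r > 0" "y \<in> sphere z r"
  obtains s where "t \<le> s" "s < t + 2 * pi" "y = on_circle z r s"
proof -
  define a where "a = Arg (y - z)"
  define k where "k = \<lfloor>(a - t) / (2 * pi)\<rfloor>"
  have "norm (y - z) = r" using assms by (simp add: dist_norm norm_minus_commute)
  then have y: "y = on_circle z r a"
    using rcis_cmod_Arg[of "y - z"] by (simp add: on_circle_def a_def rcis_def algebra_simps)
  show thesis
  proof (rule that[of "a - 2 * pi * of_int k"])
    have "of_int k \<le> (a - t) / (2 * pi)" "(a - t) / (2 * pi) < of_int k + 1"
      by (simp_all add: k_def)
    then show "t \<le> a - 2 * pi * of_int k" "a - 2 * pi * of_int k < t + 2 * pi"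
      by (simp_all add: pos_le_divide_eq pos_divide_less_eq algebra_simps)
    have "cis (a - 2 * pi * of_int k) = cis a"
      by (simp add: cis_multiple_2pi flip: cis_divide)
    then show "y = on_circle z r (a - 2 * pi * of_int k)" by (simp add: y on_circle_def)
  qed
qed

text \<open>The bound on \<open>b\<close> admits a full turn, where both ends are the same point;
  such an arc arises on a circle with a single system point.\<close>

lemma closure_open_circle_arc:
  assumes "r > 0" "a < b" "b \<le> a + 2 * pi"
  shows "closure (on_circle z r ` {a<..<b}) - on_circle z r ` {a<..<b} = {on_circle z r a, on_circle z r b}"
proof -
  have "closure (on_circle z r ` {a<..<b}) = on_circle z r ` {a..b}"
  proof
    have "compact (on_circle z r ` {a..b})" by (intro compact_continuous_image continuous_on_circle) auto
    then show "closure (on_circle z r ` {a<..<b}) \<subseteq> on_circle z r ` {a..b}"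
      by (intro closure_minimal compact_imp_closed) auto
    have "on_circle z r ` closure {a<..<b} \<subseteq> closure (on_circle z r ` {a<..<b})"
      by (intro image_closure_subset continuous_on_circle closure_subset) auto
    then show "on_circle z r ` {a..b} \<subseteq> closure (on_circle z r ` {a<..<b})" using assms by simp
  qed
  moreover have "on_circle z r a \<notin> on_circle z r ` {a<..<b}" "on_circle z r b \<notin> on_circle z r ` {a<..<b}"
    using assms by (force dest: on_circle_inj)+
  moreover have "{a..b} = {a<..<b} \<union> {a, b}" using assms by auto
  ultimately show ?thesis by auto
qed

lemma increasing_bracket:
  fixes t :: "nat \<Rightarrow> 'a::linorder"
  shows "t 0 \<le> s \<Longrightarrow> s < t m \<Longrightarrow> \<exists>i<m. t i \<le> s \<and> s < t (Suc i)"
proof (induction m)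
  case (Suc m)
  then show ?case by (cases "s < t m") (auto simp: less_Suc_eq)
qed simp

text \<open>Cutting the circle open at \<open>x\<close> turns it into an interval of angles of
  length \<open>2 * pi\<close>, in which the points of \<open>P\<close> can be sorted; neighbours in
  this order bound the arcs.\<close>

lemma circle_cut:
  assumes "r > 0" "finite P" "P \<subseteq> sphere z r" "x \<in> P"
  obtains m :: nat and t :: "nat \<Rightarrow> real" where "m > 0"
    "strict_mono_on {..m} t" "t m = t 0 + 2 * pi" "on_circle z r (t 0) = x"
    "(\<lambda>i. on_circle z r (t i)) ` {..<m} = P"
    "components (sphere z r - P) = (\<lambda>i. on_circle z r ` {t i<..<t (Suc i)}) ` {..<m}"
proof -
  let ?\<phi> = "on_circle z r"
  obtain t0 where x: "x = ?\<phi> t0" using sphere_on_circle[of r x z 0] assms by blast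
  define \<Theta> where "\<Theta> = {s \<in> {t0..<t0 + 2 * pi}. ?\<phi> s \<in> P}"
  have inj: "s = s'" if "?\<phi> s = ?\<phi> s'" "s \<in> {t0..<t0 + 2 * pi}" "s' \<in> {t0..<t0 + 2 * pi}" for s s'
    using that on_circle_inj[OF \<open>r > 0\<close> that(1)] by auto
  have "finite \<Theta>"
    by (rule finite_imageD[of ?\<phi>]) (use assms inj in \<open>auto simp: \<Theta>_def inj_on_def intro: finite_subset\<close>)
  define l where "l = sorted_list_of_set \<Theta>"
  define m where "m = length l"
  \<comment> \<open>Index \<open>m\<close> is no further point but the start \<open>x\<close> after
    a full turn, so that the last arc has the same form as the others.\<close>
  define t where "t i = (if i < m then l ! i else t0 + 2 * pi)" for i
  have l: "set l = \<Theta>" "sorted_wrt (<) l"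
    using \<open>finite \<Theta>\<close> by (auto simp: l_def strict_sorted_list_of_set)
  have t0: "t0 \<in> \<Theta>" using assms x by (auto simp: \<Theta>_def)
  have t\<Theta>: "t i \<in> \<Theta>" if "i < m" for i using that l(1) by (auto simp: t_def m_def)
  have \<Theta>t: "\<exists>i<m. s = t i" if s: "s \<in> \<Theta>" for s
  proof -
    obtain i where "i < length l" "l ! i = s" using s l(1) by (metis in_set_conv_nth)
    then show ?thesis by (intro exI[of _ i]) (simp add: t_def m_def)
  qed
  have mono: "t i < t j" if "i < j" "j \<le> m" for i j
  proof (cases "j < m")
    case True
    then show ?thesis using that l(2) by (auto simp: t_def m_def sorted_wrt_iff_nth_less)
  next
    case False
    then have "t j = t0 + 2 * pi" "i < m" using that by (auto simp: t_def)
    then show ?thesis using t\<Theta>[of i] by (auto simp: \<Theta>_def)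
  qed
  have m: "m > 0" using t0 l by (auto simp: m_def)
  have start: "t 0 = t0"
  proof -
    obtain i where i: "i < m" "t0 = t i" using \<Theta>t[OF t0] by blast
    have "t0 \<le> t 0" using t\<Theta>[OF m] by (auto simp: \<Theta>_def)
    then show ?thesis using mono[of 0 i] i by (cases "i = 0") auto
  qed
  have end_t: "t m = t0 + 2 * pi" by (simp add: t_def)
  have ends: "?\<phi> (t i) \<in> P" if "i \<le> m" for i
    using that t\<Theta>[of i] assms x by (cases "i = m") (auto simp: end_t on_circle_2pi \<Theta>_def)
  have range: "t0 \<le> s \<and> s < t0 + 2 * pi" if "i < m" "t i \<le> s" "s < t (Suc i)" for i s
    using that start end_t mono[of 0 i] mono[of "Suc i" m]
    by (cases "i = 0"; cases "Suc i = m") auto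
  have gap: "?\<phi> s \<notin> P" if i: "i < m" "t i < s" "s < t (Suc i)" for i s
  proof
    assume "?\<phi> s \<in> P"
    then have "s \<in> \<Theta>" using range[of i s] i by (auto simp: \<Theta>_def)
    then obtain j where j: "j < m" "s = t j" using \<Theta>t by blast
    then show False using mono[of j i] mono[of "Suc i" j] i
      by (cases "Suc i = j"; cases j i rule: linorder_cases) auto
  qed
  let ?A = "\<lambda>i. ?\<phi> ` {t i<..<t (Suc i)}"
  have "components (sphere z r - P) = ?A ` {..<m}"
  proof (rule components_finite_closed_partition)
    show "\<Union> (?A ` {..<m}) = sphere z r - P"
    proof
      show "\<Union> (?A ` {..<m}) \<subseteq> sphere z r - P"
        using gap by (auto simp del: mem_sphere simp: on_circle_in_sphere[OF \<open>r > 0\<close>])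
    next
      show "sphere z r - P \<subseteq> \<Union> (?A ` {..<m})"
      proof
        fix y assume y: "y \<in> sphere z r - P"
        then obtain s where s: "t 0 \<le> s" "s < t m" "y = ?\<phi> s"
          using sphere_on_circle[of r y z t0] \<open>r > 0\<close> start end_t by (metis DiffD1)
        obtain i where i: "i < m" "t i \<le> s" "s < t (Suc i)" using increasing_bracket[OF s(1,2)] by blast
        then have "t i \<noteq> s" using ends[of i] y s by auto
        then have "y \<in> ?A i" unfolding s(3) using i by (intro imageI) simp
        then show "y \<in> \<Union> (?A ` {..<m})" using i(1) by blast
      qed
    qed
    show "pairwise disjnt (?A ` {..<m})"
    proof (rule pairwise_imageI)
      fix i j assume ij: "i \<in> {..<m}" "j \<in> {..<m}" "i \<noteq> j"
      show "disjnt (?A i) (?A j)"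
      proof (rule ccontr)
        assume "\<not> disjnt (?A i) (?A j)"
        then obtain s s' where s: "t i < s" "s < t (Suc i)" "t j < s'" "s' < t (Suc j)" "?\<phi> s = ?\<phi> s'"
          by (auto simp: disjnt_def)
        then have "s = s'" using inj[of s s'] range[of i s] range[of j s'] ij by auto
        then show False
          using s ij mono[of "Suc i" j] mono[of "Suc j" i]
          by (cases "Suc i = j"; cases "Suc j = i"; cases i j rule: linorder_cases) auto
      qed
    qed
    fix X assume "X \<in> ?A ` {..<m}"
    then obtain i where i: "i < m" "X = ?A i" by auto
    have "?\<phi> ` {t i..t (Suc i)} \<inter> (sphere z r - P) = ?A i"
    proof -
      have "{t i..t (Suc i)} = {t i<..<t (Suc i)} \<union> {t i, t (Suc i)}" using mono[of i "Suc i"] i by auto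
      then show ?thesis
        using gap on_circle_in_sphere[OF \<open>r > 0\<close>] ends[of i] ends[of "Suc i"] i by auto
    qed
    moreover have "closed (?\<phi> ` {t i..t (Suc i)})"
      by (intro compact_imp_closed compact_continuous_image continuous_on_circle) auto
    ultimately have "closedin (top_of_set (sphere z r - P)) X"
      unfolding i by (metis closedin_closed inf_commute)
    moreover have "Topological_Spaces.connected X" unfolding i by (intro connected_continuous_image continuous_on_circle) auto
    moreover have "X \<noteq> {}" using mono[of i "Suc i"] i by auto
    ultimately show "Topological_Spaces.connected X \<and> X \<noteq> {} \<and> closedin (top_of_set (sphere z r - P)) X" by blast
  qed simp
  moreover have "(\<lambda>i. ?\<phi> (t i)) ` {..<m} = P"
  proof
    show "(\<lambda>i. ?\<phi> (t i)) ` {..<m} \<subseteq> P" using ends by auto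
    show "P \<subseteq> (\<lambda>i. ?\<phi> (t i)) ` {..<m}"
    proof
      fix y assume y: "y \<in> P"
      then obtain s where s: "t0 \<le> s" "s < t0 + 2 * pi" "y = ?\<phi> s"
        using sphere_on_circle[of r y z t0] assms by (metis subsetD)
      then have "s \<in> \<Theta>" using y by (auto simp: \<Theta>_def)
      then show "y \<in> (\<lambda>i. ?\<phi> (t i)) ` {..<m}" using \<Theta>t s by auto
    qed
  qed
  ultimately show thesis using that[of m t] m strict_mono_onI[of "{..m}" t] mono start end_t x by auto
qed

section \<open>Realizations as systems of circles\<close>

text \<open>The similarity \<open>h\<close> moves the centres to 0 and 1. The distances to both
  centres then fix the real part and the square of the imaginary part, so distinct common points
  have opposite imaginary parts, which is impossible for three points pairwise.\<close>

lemma spheres_eq_if_three_common_points: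
  fixes z w :: complex
  assumes "a \<noteq> b" "b \<noteq> c" "a \<noteq> c" "{a, b, c} \<subseteq> sphere z r \<inter> sphere w s"
  shows "sphere z r = sphere w s"
proof (cases "z = w")
  case False
  define h where "h x = (x - z) / (w - z)" for x
  define A B where "A = (r / dist z w)\<^sup>2" and "B = (s / dist z w)\<^sup>2"
  have ReIm: "Re (h x) = (1 + A - B) / 2" "(Im (h x))\<^sup>2 = A - ((1 + A - B) / 2)\<^sup>2" if "x \<in> {a, b, c}" for x
  proof -
    have x: "dist z x = r" "dist w x = s" using assms that by auto
    have n1: "norm (h x) = r / dist z w"
      using x by (simp add: h_def norm_divide dist_norm norm_minus_commute)
    have "h x - 1 = (x - w) / (w - z)" using False by (simp add: h_def field_simps)
    then have n2: "norm (h x - 1) = s / dist z w"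
      using x by (simp add: norm_divide dist_norm norm_minus_commute)
    have a: "(Re (h x))\<^sup>2 + (Im (h x))\<^sup>2 = A" unfolding A_def n1[symmetric] cmod_power2 ..
    have "(Re (h x) - 1)\<^sup>2 + (Im (h x))\<^sup>2 = B" unfolding B_def n2[symmetric] cmod_power2 by simp
    then have "(Re (h x))\<^sup>2 - 2 * Re (h x) + 1 + (Im (h x))\<^sup>2 = B" by (simp add: power2_diff)
    then show re: "Re (h x) = (1 + A - B) / 2" using a by (simp add: field_simps)
    show "(Im (h x))\<^sup>2 = A - ((1 + A - B) / 2)\<^sup>2" using a unfolding re by (simp add: algebra_simps)
  qed
  have h: "Re (h x) = Re (h y) \<and> (Im (h x) = Im (h y) \<or> Im (h x) = - Im (h y))"
    if "x \<in> {a, b, c}" "y \<in> {a, b, c}" for x y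
    using ReIm[OF that(1)] ReIm[OF that(2)] power2_eq_iff[of "Im (h x)" "Im (h y)"] by metis
  have inj: "x = y" if "h x = h y" for x y using that False by (simp add: h_def)
  have "Im (h a) = - Im (h b)" "Im (h b) = - Im (h c)"
    using h[of a b] h[of b c] inj[of a b] inj[of b c] assms(1,2) by (auto simp: complex_eq_iff)
  then have "h a = h c" using h[of a c] by (simp add: complex_eq_iff)
  then show ?thesis using inj[of a c] assms(3) by blast
next
  case True
  have "dist z a = r" "dist w a = s" using assms(4) by auto
  then show ?thesis using True by simp
qed

lemma even_card_sym_irrefl:
  assumes "finite R" "sym R" "irrefl R"
  shows "even (card R)"
  using assms
proof (induction "card R" arbitrary: R rule: less_induct)
  case less
  show ?case
  proof (cases "R = {}")
    case False
    then obtain u v where uv: "(u, v) \<in> R" by auto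
    then have R: "(v, u) \<in> R" "u \<noteq> v" using less.prems by (auto simp: sym_def irrefl_def)
    define R' where "R' = R - {(u, v), (v, u)}"
    have "R = insert (u, v) (insert (v, u) R')" using uv R by (auto simp: R'_def)
    moreover have "finite R'" "(u, v) \<notin> insert (v, u) R'" "(v, u) \<notin> R'"
      using less.prems R by (auto simp: R'_def)
    ultimately have card: "card R = card R' + 2" by simp
    moreover have "even (card R')"
      using less.prems card by (intro less.hyps) (auto simp: R'_def sym_def irrefl_def)
    ultimately show ?thesis by simp
  qed simp
qed

section \<open>Circles of a realization as cycles of the graph\<close>

locale realization = pair_graph G for G :: "'a pair_pre_digraph" +
  fixes \<C> :: "complex set set" and f :: "'a \<Rightarrow> complex" and g :: "'a set \<Rightarrow> complex set"
  assumes circle_system: "circle_system \<C>"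
    and bij_f: "bij_betw f (pverts G) (system_points \<C>)"
    and bij_g: "bij_betw g (uedges G) (system_arcs \<C>)"
    and arc_ends_g: "\<And>e. e \<in> uedges G \<Longrightarrow> arc_ends (g e) = f ` e"
begin

abbreviation "P \<equiv> system_points \<C>"

text \<open>The choice is unique (\<open>circle_of_eqI\<close>): distinct circles meet only in
  \<open>P\<close>, and arcs avoid \<open>P\<close>.\<close>

definition circle_of :: "'a set \<Rightarrow> complex set" where
  "circle_of e = (SOME c. c \<in> \<C> \<and> g e \<in> components (c - P))"

definition nbrs :: "complex set \<Rightarrow> 'a \<Rightarrow> 'a set" where
  "nbrs c v = {w. (v, w) \<in> parcs G \<and> circle_of {v, w} = c}"

lemma P_eq: "P = f ` pverts G" and inj_f: "inj_on f (pverts G)"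
  using bij_f by (auto simp: bij_betw_def)

lemma finite_P: "finite P" by (simp add: P_eq pair_finite_verts)

lemma uedgesI: "(u, v) \<in> parcs G \<Longrightarrow> {u, v} \<in> uedges G"
  by (auto simp: uedges_def)

lemma uedgesE:
  assumes "e \<in> uedges G"
  obtains u v where "e = {u, v}" "(u, v) \<in> parcs G" "u \<noteq> v" "u \<in> pverts G" "v \<in> pverts G"
proof -
  obtain u v where "e = {u, v}" "(u, v) \<in> parcs G" using assms by (auto simp: uedges_def)
  then show thesis using that no_loops'[of u v] wellformed'[of u v] by simp
qed

lemma uedge_arcs: "{u, v} \<in> uedges G \<Longrightarrow> (u, v) \<in> parcs G"
  using arcs_symmetric[of v u] by (auto simp: uedges_def doubleton_eq_iff)

lemma circleE:
  assumes "c \<in> \<C>"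
  obtains z r where "r > 0" "c = sphere z r"
  using circle_system assms by (auto simp: circle_system_def)

lemma common_points: "c \<in> \<C> \<Longrightarrow> d \<in> \<C> \<Longrightarrow> c \<noteq> d \<Longrightarrow> c \<inter> d \<subseteq> P"
  by (auto simp: system_points_def)

lemma circle_of:
  assumes "e \<in> uedges G"
  shows "circle_of e \<in> \<C>" "g e \<in> components (circle_of e - P)"
proof -
  have "g e \<in> system_arcs \<C>" using bij_g assms by (auto simp: bij_betw_def)
  then have "\<exists>c. c \<in> \<C> \<and> g e \<in> components (c - P)" by (auto simp: system_arcs_def)
  then show "circle_of e \<in> \<C>" "g e \<in> components (circle_of e - P)"
    unfolding circle_of_def by (metis (mono_tags, lifting) someI_ex)+
qed

lemma circle_of_eqI:
  assumes "e \<in> uedges G" "c \<in> \<C>" "g e \<in> components (c - P)"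
  shows "circle_of e = c"
proof (rule ccontr)
  assume "circle_of e \<noteq> c"
  moreover have "g e \<subseteq> circle_of e - P" "g e \<subseteq> c - P" "g e \<noteq> {}"
    using assms circle_of[OF assms(1)] by (auto dest: in_components_subset in_components_nonempty)
  ultimately show False using common_points[OF circle_of(1)[OF assms(1)] assms(2)] by blast
qed

lemma end_on_circle:
  assumes "(u, v) \<in> parcs G"
  shows "f u \<in> circle_of {u, v}" "f v \<in> circle_of {u, v}"
proof -
  note e = uedgesI[OF assms]
  obtain z r where "circle_of {u, v} = sphere z r" using circleE[OF circle_of(1)[OF e]] by metis
  moreover from this have "closure (g {u, v}) \<subseteq> sphere z r"
    using in_components_subset[OF circle_of(2)[OF e]] by (intro closure_minimal) auto
  moreover have "f ` {u, v} \<subseteq> closure (g {u, v})" using arc_ends_g[OF e] by (auto simp: arc_ends_def)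
  ultimately show "f u \<in> circle_of {u, v}" "f v \<in> circle_of {u, v}" by auto
qed

text \<open>The arcs between system points that are consecutive on \<open>c\<close> are images of
  edges, so the circle traces a cycle of the graph, here started at \<open>v\<close>. That the graph
  is simple gives \<open>m \<ge> 3\<close>: a single point would yield a loop, and two points would
  yield two arcs for the same edge.\<close>

lemma circuit:
  assumes c: "c \<in> \<C>" and v: "v \<in> pverts G" "f v \<in> c"
  obtains R z m t q where "R > 0" "c = sphere z R" "m \<ge> 3"
    "strict_mono_on {..m} t" "t m = t 0 + 2 * pi"
    "q 0 = v" "q m = v" "\<forall>i\<le>m. f (q i) = on_circle z R (t i)"
    "inj_on q {..<m}" "q ` {..<m} = {u \<in> pverts G. f u \<in> c}"
    "\<forall>u w. (u, w) \<in> parcs G \<and> circle_of {u, w} = c \<longleftrightarrow> (\<exists>i<m. {u, w} = {q i, q (Suc i)})"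
proof -
  obtain z R where R: "R > 0" "c = sphere z R" using circleE[OF c] by metis
  have cP: "finite (c \<inter> P)" "c \<inter> P \<subseteq> sphere z R" "f v \<in> c \<inter> P"
    using finite_P R v P_eq by auto
  obtain m t where m: "m > 0" and smono: "strict_mono_on {..m} t"
    and t: "t m = t 0 + 2 * pi" "on_circle z R (t 0) = f v"
    and pts: "(\<lambda>i. on_circle z R (t i)) ` {..<m} = c \<inter> P"
    and comps: "components (sphere z R - (c \<inter> P)) = (\<lambda>i. on_circle z R ` {t i<..<t (Suc i)}) ` {..<m}"
    by (rule circle_cut[OF R(1) cP])
  have mono: "t i < t j" if "i < j" "j \<le> m" for i j
    using that strict_mono_onD[OF smono, of i j] by auto
  define A where "A i = on_circle z R ` {t i<..<t (Suc i)}" for i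
  have comps': "components (c - P) = A ` {..<m}"
    using comps by (simp add: R(2) A_def[abs_def] Diff_Int)
  define q where "q i = the_inv_into (pverts G) f (on_circle z R (t i))" for i
  have tm: "on_circle z R (t m) = f v" by (simp add: t on_circle_2pi)
  have on: "on_circle z R (t i) \<in> c \<inter> P" if "i \<le> m" for i
    using that pts tm cP(3) by (cases "i = m") auto
  have fq: "f (q i) = on_circle z R (t i)" and qV: "q i \<in> pverts G" if "i \<le> m" for i
    using on[OF that] unfolding q_def P_eq
    by (auto intro: f_the_inv_into_f[OF inj_f] the_inv_into_into[OF inj_f])
  have ends: "arc_ends (A i) = {f (q i), f (q (Suc i))}" if "i < m" for i
  proof -
    have "t (Suc i) \<le> t i + 2 * pi"
      using mono[of 0 i] mono[of "Suc i" m] that t by (cases "i = 0"; cases "Suc i = m") auto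
    then show ?thesis
      using closure_open_circle_arc[OF R(1) mono[of i "Suc i"], of z] that fq[of i] fq[of "Suc i"]
      by (simp add: arc_ends_def A_def)
  qed
  have edge: "e = {q i, q (Suc i)}" if "e \<in> uedges G" "g e = A i" "i < m" for e i
  proof -
    have "f ` e = f ` {q i, q (Suc i)}" using arc_ends_g[OF that(1)] ends[OF that(3)] that(2) by simp
    moreover have "e \<subseteq> pverts G" using that(1) by (auto elim: uedgesE)
    moreover have "{q i, q (Suc i)} \<subseteq> pverts G" using qV that by simp
    ultimately show ?thesis using inj_on_image_eq_iff[OF inj_f] by blast
  qed
  have ex: "{q i, q (Suc i)} \<in> uedges G \<and> g {q i, q (Suc i)} = A i" if "i < m" for i
  proof -
    have "A i \<in> system_arcs \<C>"
      using comps' that c cP(3) by (auto simp: system_arcs_def)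
    then obtain e where e: "e \<in> uedges G" "g e = A i" using bij_g by (metis bij_betw_imp_surj_on imageE)
    then show ?thesis using edge[OF e that] by simp
  qed
  have ne: "q i \<noteq> q (Suc i)" if "i < m" for i
    using ex[OF that] by (auto elim!: uedgesE simp: doubleton_eq_iff)
  have q0: "q 0 = v" "q m = v"
    using the_inv_into_f_f[OF inj_f v(1)] by (simp_all add: q_def tm t(2))
  have inj: "inj_on q {..<m}"
  proof (rule inj_onI)
    fix i j assume ij: "i \<in> {..<m}" "j \<in> {..<m}" "q i = q j"
    have *: "t 0 \<le> t k \<and> t k < t 0 + 2 * pi" if "k < m" for k
      using that mono[of 0 k] mono[of k m] t(1) by (cases "k = 0") auto
    have "\<bar>t i - t j\<bar> < 2 * pi" using *[of i] *[of j] ij by auto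
    moreover have "on_circle z R (t i) = on_circle z R (t j)" using fq[of i] fq[of j] ij by simp
    ultimately have "t i = t j" using on_circle_inj[OF R(1)] by blast
    then show "i = j" using mono[of i j] mono[of j i] ij by (cases i j rule: linorder_cases) auto
  qed
  have "m \<ge> 3"
  proof (rule ccontr)
    assume "\<not> m \<ge> 3"
    then consider "m = 1" | "m = 2" using m by linarith
    then show False
    proof cases
      case 1
      then show ?thesis using ne[of 0] q0 by simp
    next
      case 2
      then have "A 0 = A 1" using ex[of 0] ex[of 1] q0 insert_commute[of "q 1" v "{}"] by (simp add: numeral_2_eq_2)
      moreover obtain s where s: "t 0 < s" "s < t 1" using mono[of 0 1] 2 dense[of "t 0" "t 1"] by auto
      then have "on_circle z R s \<in> A 0" by (simp add: A_def)
      ultimately obtain s' where "t 1 < s'" "s' < t 2" "on_circle z R s = on_circle z R s'"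
        by (auto simp: A_def numeral_2_eq_2)
      then show ?thesis using on_circle_inj[OF R(1), of z s s'] s t(1) 2 by auto
    qed
  qed
  moreover have "q ` {..<m} = {u \<in> pverts G. f u \<in> c}"
  proof
    show "q ` {..<m} \<subseteq> {u \<in> pverts G. f u \<in> c}" using qV fq on by auto
    show "{u \<in> pverts G. f u \<in> c} \<subseteq> q ` {..<m}"
    proof clarify
      fix u assume u: "u \<in> pverts G" "f u \<in> c"
      then obtain i where "i < m" "f u = on_circle z R (t i)" using pts P_eq by (auto simp: image_iff set_eq_iff)
      then show "u \<in> q ` {..<m}" using the_inv_into_f_f[OF inj_f u(1)] by (auto simp: q_def)
    qed
  qed
  moreover have "(u, w) \<in> parcs G \<and> circle_of {u, w} = c \<longleftrightarrow> (\<exists>i<m. {u, w} = {q i, q (Suc i)})" for u w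
  proof
    assume "(u, w) \<in> parcs G \<and> circle_of {u, w} = c"
    then have e: "{u, w} \<in> uedges G" "g {u, w} \<in> components (c - P)" using uedgesI circle_of by auto
    then show "\<exists>i<m. {u, w} = {q i, q (Suc i)}" using edge comps' by auto
  next
    assume "\<exists>i<m. {u, w} = {q i, q (Suc i)}"
    then obtain i where i: "i < m" "{u, w} = {q i, q (Suc i)}" by blast
    then have "{u, w} \<in> uedges G" "g {u, w} \<in> components (c - P)" using ex comps' by auto
    then show "(u, w) \<in> parcs G \<and> circle_of {u, w} = c" using circle_of_eqI c uedge_arcs by auto
  qed
  ultimately show thesis using that[OF R _ smono t(1) q0 _ inj] fq by simp
qed

lemma nbrs_off_circle: "f v \<notin> c \<Longrightarrow> nbrs c v = {}"
  using end_on_circle by (auto simp: nbrs_def)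

text \<open>With the circuit started at \<open>v\<close>, the neighbours along \<open>c\<close> are
  its entries 1 and \<open>m - 1\<close>, which differ because \<open>m \<ge> 3\<close>.\<close>

lemma card_nbrs:
  assumes "c \<in> \<C>" "v \<in> pverts G" "f v \<in> c"
  shows "card (nbrs c v) = 2"
proof -
  obtain R z m t q where "R > 0" "c = sphere z R" and m: "m \<ge> 3"
    and "strict_mono_on {..m} t" "t m = t 0 + 2 * pi" and q: "q 0 = v" "q m = v"
    and "\<forall>i\<le>m. f (q i) = on_circle z R (t i)"
    and inj: "inj_on q {..<m}" and "q ` {..<m} = {u \<in> pverts G. f u \<in> c}"
    and e: "\<forall>u w. (u, w) \<in> parcs G \<and> circle_of {u, w} = c \<longleftrightarrow> (\<exists>i<m. {u, w} = {q i, q (Suc i)})"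
    by (rule circuit[OF assms])
  have v0: "i = 0" if "i < m" "q i = v" for i using inj_onD[OF inj, of i 0] that q m by auto
  have vm: "Suc i = m" if "i < m" "q (Suc i) = v" for i
    using inj_onD[OF inj, of "Suc i" 0] that q m by (cases "Suc i = m") auto
  have "nbrs c v = {q 1, q (m - 1)}"
  proof
    show "nbrs c v \<subseteq> {q 1, q (m - 1)}"
    proof
      fix w assume "w \<in> nbrs c v"
      then obtain i where "i < m" "{v, w} = {q i, q (Suc i)}" using e by (auto simp: nbrs_def)
      then show "w \<in> {q 1, q (m - 1)}" using v0[of i] vm[of i] by (auto simp: doubleton_eq_iff)
    qed
    have "\<exists>i<m. {v, q 1} = {q i, q (Suc i)}" using q m by (intro exI[of _ 0]) auto
    moreover have "\<exists>i<m. {v, q (m - 1)} = {q i, q (Suc i)}"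
      using q m by (intro exI[of _ "m - 1"]) auto
    ultimately show "{q 1, q (m - 1)} \<subseteq> nbrs c v" using e by (auto simp: nbrs_def)
  qed
  moreover have "q 1 \<noteq> q (m - 1)" using inj_onD[OF inj, of 1 "m - 1"] m by auto
  ultimately show ?thesis by simp
qed

lemma nbrs_eqI:
  assumes "w1 \<noteq> w2" "w1 \<in> nbrs c v" "w2 \<in> nbrs c v"
  shows "nbrs c v = {w1, w2}"
proof -
  have "(v, w1) \<in> parcs G" "c = circle_of {v, w1}" using assms by (auto simp: nbrs_def)
  then have "card (nbrs c v) = 2"
    using circle_of(1)[OF uedgesI] end_on_circle wellformed' by (intro card_nbrs) auto
  then show ?thesis
    using assms card_subset_eq[of "nbrs c v" "{w1, w2}"] by (auto simp: card_ge_0_finite)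
qed

text \<open>A walk round the circuit from \<open>v\<close> never leaves \<open>S\<close>. This later
  confines the vertices of \<open>C\<close> to the rim and those of \<open>D i\<close> to one
  link.\<close>

lemma circle_subset_closed:
  assumes "c \<in> \<C>" "v \<in> pverts G" "f v \<in> c" "v \<in> S" and S: "\<And>u. u \<in> S \<Longrightarrow> nbrs c u \<subseteq> S"
    and u: "u \<in> pverts G" "f u \<in> c"
  shows "u \<in> S"
proof -
  obtain R z m t q where "R > 0" "c = sphere z R" "m \<ge> 3"
    "strict_mono_on {..m} t" "t m = t 0 + 2 * pi" and q: "q 0 = v" and "q m = v"
    "\<forall>i\<le>m. f (q i) = on_circle z R (t i)"
    "inj_on q {..<m}" and qs: "q ` {..<m} = {u \<in> pverts G. f u \<in> c}"
    and e: "\<forall>u w. (u, w) \<in> parcs G \<and> circle_of {u, w} = c \<longleftrightarrow> (\<exists>i<m. {u, w} = {q i, q (Suc i)})"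
    by (rule circuit[OF assms(1-3)])
  have "q i \<in> S" if "i < m" for i
    using that
  proof (induction i)
    case (Suc i)
    have "\<exists>j<m. {q i, q (Suc i)} = {q j, q (Suc j)}" using Suc by (intro exI[of _ i]) simp
    then have "q (Suc i) \<in> nbrs c (q i)" using e by (simp add: nbrs_def)
    then show ?case using S[of "q i"] Suc by auto
  qed (use assms q in auto)
  moreover have "u \<in> q ` {..<m}" unfolding qs using u by simp
  ultimately show ?thesis by auto
qed

text \<open>Count the pairs of neighbours along \<open>c\<close> that start in \<open>W\<close>.
  Every vertex contributes 0 or 2, and the pairs inside \<open>W\<close> occur in both orders, so an
  even number is left for the boundary.\<close>

lemma even_card_boundary:
  assumes "W \<subseteq> pverts G" "c \<in> \<C>"
  shows "even (card {(u, w). u \<in> W \<and> w \<notin> W \<and> w \<in> nbrs c u})" (is "even (card ?B)")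
proof -
  let ?A = "Sigma W (nbrs c)"
  let ?I = "{(u, w). u \<in> W \<and> w \<in> W \<and> w \<in> nbrs c u}"
  have fin: "finite W" using assms pair_finite_verts by (auto intro: finite_subset)
  have sub: "?A \<subseteq> parcs G" by (auto simp: nbrs_def)
  then have finA: "finite ?A" using pair_finite_arcs by (rule finite_subset)
  have fnb: "finite (nbrs c u)" for u
    using pair_finite_verts by (rule finite_subset[rotated]) (auto simp: nbrs_def wellformed')
  have "card ?A = (\<Sum>u\<in>W. card (nbrs c u))" using fin fnb by (simp add: card_SigmaI)
  moreover have "even (card (nbrs c u))" if "u \<in> W" for u
    using card_nbrs[of c u] nbrs_off_circle[of u c] assms that by (cases "f u \<in> c") auto
  ultimately have "even (card ?A)" by (simp add: dvd_sum)
  moreover have "?A = ?I \<union> ?B" by auto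
  moreover have "card (?I \<union> ?B) = card ?I + card ?B"
    using finA by (intro card_Un_disjoint) (auto elim: finite_subset[rotated])
  moreover have "even (card ?I)"
  proof (rule even_card_sym_irrefl)
    show "finite ?I" using finA by (rule finite_subset[rotated]) auto
    show "sym ?I" by (auto simp: sym_def nbrs_def insert_commute arcs_symmetric)
    show "irrefl ?I" by (auto simp: irrefl_def nbrs_def dest: no_loops')
  qed
  ultimately show ?thesis by simp
qed

lemma two_edge_cut_same_circle:
  assumes W: "W \<subseteq> pverts G" and ne: "(a, x) \<noteq> (b, y)"
    and cut: "{(u, w) \<in> parcs G. u \<in> W \<and> w \<notin> W} = {(a, x), (b, y)}"
  shows "circle_of {a, x} = circle_of {b, y}"
proof (rule ccontr)
  assume diff: "circle_of {a, x} \<noteq> circle_of {b, y}"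
  have arc: "(a, x) \<in> parcs G" using cut by blast
  have "{(u, w). u \<in> W \<and> w \<notin> W \<and> w \<in> nbrs (circle_of {a, x}) u}
      = {(u, w) \<in> {(u, w) \<in> parcs G. u \<in> W \<and> w \<notin> W}. circle_of {u, w} = circle_of {a, x}}"
    by (auto simp: nbrs_def)
  also have "\<dots> = {(a, x)}" unfolding cut using diff by auto
  finally show False using even_card_boundary[OF W circle_of(1)[OF uedgesI[OF arc]]] by simp
qed

lemma circles_share_three:
  assumes "c \<in> \<C>" "d \<in> \<C>" "{u, v, w} \<subseteq> pverts G" "u \<noteq> v" "v \<noteq> w" "u \<noteq> w" "f ` {u, v, w} \<subseteq> c \<inter> d"
  shows "c = d"
proof -
  obtain z r z' r' where c: "c = sphere z r" "d = sphere z' r'" using assms(1,2) by (metis circleE)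
  have "f u \<noteq> f v" "f v \<noteq> f w" "f u \<noteq> f w" using assms inj_onD[OF inj_f] by blast+
  then show ?thesis unfolding c
    by (rule spheres_eq_if_three_common_points) (use assms(7) c in auto)
qed

end

section \<open>The graphs\<close>

datatype vert = X nat | Z nat | H nat nat

text \<open>Chords 0 and 2 join the block 0, 1 to the block 4, 5, and chords 1 and 3 join 2, 3 to 6,
  7. Hence each chord of one pair interlaces both chords of the other, while the chords within a
  pair do not interlace.\<close>

definition chord :: "nat \<Rightarrow> nat" where
  "chord i = [2, 0, 3, 1, 0, 2, 1, 3] ! i"

definition chord_end :: "nat \<Rightarrow> nat" where
  "chord_end k = [1, 3, 0, 2] ! k"

definition chord_end' :: "nat \<Rightarrow> nat" where
  "chord_end' k = [4, 6, 5, 7] ! k"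

text \<open>The chords join 1 to 4, 3 to 6, 0 to 5 and 2 to 7.  A strand is an antiprism without one edge: the
  even and the odd indices form its two cycles, which are closed by \<open>top\<close> and \<open>bottom\<close> if \<open>m\<close> is odd.\<close>
inductive_set base_arcs :: "nat \<Rightarrow> (vert \<times> vert) set" for m where
  rim: "i < 8 \<Longrightarrow> (X i, X (Suc i mod 8)) \<in> base_arcs m"
| direct: "i < 8 \<Longrightarrow> (X i, Z (chord i)) \<in> base_arcs m"
| enter: "i < 8 \<Longrightarrow> (X i, H i 0) \<in> base_arcs m"
| leave: "i < 8 \<Longrightarrow> (H i m, Z (chord i)) \<in> base_arcs m"
| zigzag: "i < 8 \<Longrightarrow> s < m \<Longrightarrow> (H i s, H i (Suc s)) \<in> base_arcs m"
| side: "i < 8 \<Longrightarrow> s + 2 \<le> m \<Longrightarrow> (H i s, H i (s + 2)) \<in> base_arcs m"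
| top: "i < 8 \<Longrightarrow> (H i 0, H i (m - 1)) \<in> base_arcs m"
| bottom: "i < 8 \<Longrightarrow> (H i 1, H i m) \<in> base_arcs m"

definition chord_graph :: "nat \<Rightarrow> vert pair_pre_digraph" where
  "chord_graph m = \<lparr>pverts = X ` {..<8} \<union> Z ` {..<4} \<union> (\<lambda>(i, s). H i s) ` ({..<8} \<times> {..m}),
     parcs = base_arcs m \<union> (base_arcs m)\<inverse>\<rparr>"

section \<open>Adjacency and regularity\<close>

text \<open>Explicit adjacency lists, from which degrees and edge cuts can be read off.
  \<open>(i + 7) mod 8\<close> is the predecessor on the rim without truncated subtraction; on a
  strand only the first two and the last two places are irregular.\<close>

fun nbhd :: "nat \<Rightarrow> vert \<Rightarrow> vert set" where
  "nbhd m (X i) = {X (Suc i mod 8), X ((i + 7) mod 8), Z (chord i), H i 0}"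
| "nbhd m (Z k) = {X (chord_end k), X (chord_end' k), H (chord_end k) m, H (chord_end' k) m}"
| "nbhd m (H i s) = (if s = 0 then {X i, H i 1, H i 2, H i (m - 1)}
     else if s = 1 then {H i 0, H i 2, H i 3, H i m}
     else if s = m - 1 then {H i m, H i (m - 2), H i (m - 3), H i 0}
     else if s = m then {Z (chord i), H i (m - 1), H i (m - 2), H i 1}
     else {H i (s - 2), H i (s - 1), H i (s + 1), H i (s + 2)})"

lemma less_4_iff: "(k::nat) < 4 \<longleftrightarrow> k = 0 \<or> k = 1 \<or> k = 2 \<or> k = 3"
  by (auto simp: numeral_eq_Suc less_Suc_eq)

lemma less_8_iff: "(i::nat) < 8 \<longleftrightarrow> i = 0 \<or> i = 1 \<or> i = 2 \<or> i = 3 \<or> i = 4 \<or> i = 5 \<or> i = 6 \<or> i = 7"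
  by (auto simp: numeral_eq_Suc less_Suc_eq)

lemma chord_less: "i < 8 \<Longrightarrow> chord i < 4"
  by (auto simp: less_8_iff chord_def)

lemma chord_eq_iff: "i < 8 \<Longrightarrow> k < 4 \<Longrightarrow> chord i = k \<longleftrightarrow> i = chord_end k \<or> i = chord_end' k"
  unfolding less_8_iff less_4_iff by (elim disjE; simp add: chord_def chord_end_def chord_end'_def)

lemma chord_ends: "k < 4 \<Longrightarrow> chord_end k < 8 \<and> chord_end' k < 8 \<and> chord_end k \<noteq> chord_end' k \<and>
    chord (chord_end k) = k \<and> chord (chord_end' k) = k"
  unfolding less_4_iff by (elim disjE; simp add: chord_def chord_end_def chord_end'_def)

lemma verts_simps [simp]:
  "X i \<in> pverts (chord_graph m) \<longleftrightarrow> i < 8"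
  "Z k \<in> pverts (chord_graph m) \<longleftrightarrow> k < 4"
  "H i s \<in> pverts (chord_graph m) \<longleftrightarrow> i < 8 \<and> s \<le> m"
  by (auto simp: chord_graph_def)

lemma base_arcs_verts:
  assumes "(u, v) \<in> base_arcs m" "m \<ge> 5"
  shows "u \<in> pverts (chord_graph m)" "v \<in> pverts (chord_graph m)" "u \<noteq> v"
proof -
  have "Suc i mod 8 < 8 \<and> i \<noteq> Suc i mod 8" for i :: nat by presburger
  then show "u \<in> pverts (chord_graph m)" "v \<in> pverts (chord_graph m)" "u \<noteq> v"
    using assms by (auto elim!: base_arcs.cases simp: chord_less)
qed

lemma parcs_iff: "(u, v) \<in> parcs (chord_graph m) \<longleftrightarrow> (u, v) \<in> base_arcs m \<or> (v, u) \<in> base_arcs m"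
  by (auto simp: chord_graph_def)

lemma finite_chord_graph: "finite (pverts (chord_graph m))"
  by (simp add: chord_graph_def)

lemma card_chord_graph: "card (pverts (chord_graph m)) = 12 + 8 * (m + 1)"
proof -
  have "card (X ` {..<8} \<union> Z ` {..<4}) = 12"
    by (subst card_Un_disjoint) (auto simp: card_image inj_on_def)
  moreover have "card ((\<lambda>(i, s). H i s) ` ({..<8} \<times> {..m})) = 8 * (m + 1)"
    by (subst card_image) (auto simp: inj_on_def)
  ultimately show ?thesis
    unfolding chord_graph_def by (simp, subst card_Un_disjoint) auto
qed

lemma pair_graph_chord_graph:
  assumes "m \<ge> 5"
  shows "pair_graph (chord_graph m)"
proof -
  have V: "fst e \<in> pverts (chord_graph m) \<and> snd e \<in> pverts (chord_graph m) \<and> fst e \<noteq> snd e"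
    if "e \<in> parcs (chord_graph m)" for e
    using that base_arcs_verts[OF _ assms, of "fst e" "snd e"] base_arcs_verts[OF _ assms, of "snd e" "fst e"]
    by (cases e) (auto simp: parcs_iff)
  then have "parcs (chord_graph m) \<subseteq> pverts (chord_graph m) \<times> pverts (chord_graph m)" by force
  then have "finite (parcs (chord_graph m))"
    using finite_chord_graph by (auto intro: finite_subset)
  moreover have "symmetric (with_proj (chord_graph m))"
    by (auto simp: symmetric_def sym_def parcs_iff)
  ultimately show ?thesis
    by unfold_locales (use V finite_chord_graph in auto)
qed

text \<open>Once \<open>m\<close> is written as \<open>n + 5\<close>, the truncated differences in
  \<open>nbhd\<close> become sums, and \<open>t + 2\<close> runs through the regular places.\<close>

lemma strand_index_cases:
  fixes s n :: nat
  assumes "s \<le> n + 5"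
  obtains "s = 0" | "s = 1" | "s = n + 4" | "s = n + 5" | t where "s = t + 2" "t \<le> n + 1"
proof -
  have "s = 0 \<or> s = 1 \<or> (\<exists>t. s = t + 2)"
    by (metis One_nat_def add_2_eq_Suc' not0_implies_Suc)
  moreover have "t \<le> n + 1 \<or> t + 2 = n + 4 \<or> t + 2 = n + 5" if "s = t + 2" for t
    using that assms by auto
  ultimately show thesis using that by blast
qed

lemma base_arcs_nbhd:
  assumes m: "m \<ge> 5" and uv: "(u, v) \<in> base_arcs m"
  shows "v \<in> nbhd m u \<and> u \<in> nbhd m v"
proof -
  obtain n where n: "m = n + 5" using m by (metis le_Suc_ex add.commute)
  from uv show ?thesis
  proof cases
    case (rim i)
    then show ?thesis by (auto simp: less_8_iff)
  next
    case (direct i)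
    then show ?thesis using chord_eq_iff[of i "chord i"] chord_less[of i] by auto
  next
    case (leave i)
    then show ?thesis using n chord_eq_iff[of i "chord i"] chord_less[of i] by auto
  next
    case (zigzag i s)
    then show ?thesis using n by simp
  next
    case (side i s)
    then show ?thesis using n by simp
  qed (use n in simp_all)
qed

lemma nbhd_arcs:
  assumes m: "m \<ge> 5" and u: "u \<in> pverts (chord_graph m)" and v: "v \<in> nbhd m u"
  shows "(u, v) \<in> parcs (chord_graph m)"
proof -
  obtain n where n: "m = n + 5" using m by (metis le_Suc_ex add.commute)
  note intros = base_arcs.intros[where m = m]
  show ?thesis
  proof (cases u)
    case (X i)
    then have i: "i < 8" using u by simp
    have "(i + 7) mod 8 < 8" "Suc ((i + 7) mod 8) mod 8 = i" using i by presburger+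
    then have "(X ((i + 7) mod 8), X i) \<in> base_arcs m" using rim[of "(i + 7) mod 8" m] by simp
    then show ?thesis using X v i intros by (auto simp: parcs_iff)
  next
    case (Z k)
    then have k: "k < 4" using u by simp
    have "(X (chord_end k), Z k) \<in> base_arcs m" "(X (chord_end' k), Z k) \<in> base_arcs m"
      "(H (chord_end k) m, Z k) \<in> base_arcs m" "(H (chord_end' k) m, Z k) \<in> base_arcs m"
      using chord_ends[OF k] direct[of _ m] leave[of _ m] by metis+
    then show ?thesis using Z v by (auto simp: parcs_iff)
  next
    case (H i s)
    then have i: "i < 8" "s \<le> m" using u by auto
    have adj: "(H i t, H i t') \<in> parcs (chord_graph m)"
      if "t \<le> m" "t' \<le> m" "t' = t + 1 \<or> t = t' + 1 \<or> t' = t + 2 \<or> t = t' + 2 \<or>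
        t = 0 \<and> t' = m - 1 \<or> t = m - 1 \<and> t' = 0 \<or> t = 1 \<and> t' = m \<or> t = m \<and> t' = 1" for t t'
      using that(3)
    proof (elim disjE)
      assume "t' = t + 1"
      then show ?thesis using zigzag[OF i(1), of t m] that by (simp add: parcs_iff)
    next
      assume "t = t' + 1"
      then show ?thesis using zigzag[OF i(1), of t' m] that by (simp add: parcs_iff)
    next
      assume "t' = t + 2"
      then show ?thesis using side[OF i(1), of t m] that by (simp add: parcs_iff)
    next
      assume "t = t' + 2"
      then show ?thesis using side[OF i(1), of t' m] that by (simp add: parcs_iff)
    qed (use top[OF i(1), of m] bottom[OF i(1), of m] in \<open>simp_all add: parcs_iff\<close>)
    have hull: "(H i 0, X i) \<in> parcs (chord_graph m)" "(H i m, Z (chord i)) \<in> parcs (chord_graph m)"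
      using enter[OF i(1), of m] leave[OF i(1), of m] by (simp_all add: parcs_iff)
    have "s \<le> n + 5" using i n by simp
    then show ?thesis
      by (cases rule: strand_index_cases) (use v H n adj hull in auto)
  qed
qed

lemma parcs_chord_graph:
  assumes "m \<ge> 5" "u \<in> pverts (chord_graph m)"
  shows "(u, v) \<in> parcs (chord_graph m) \<longleftrightarrow> v \<in> nbhd m u"
  using base_arcs_nbhd[OF assms(1), of u v] base_arcs_nbhd[OF assms(1), of v u] nbhd_arcs[OF assms, of v]
  by (auto simp: parcs_iff)

lemma card_nbhd:
  assumes m: "m \<ge> 5" and u: "u \<in> pverts (chord_graph m)"
  shows "card (nbhd m u) = 4"
proof (cases u)
  case (X i)
  then have "Suc i mod 8 \<noteq> (i + 7) mod 8" using u by simp presburger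
  then show ?thesis using X by simp
next
  case (Z k)
  then show ?thesis using u chord_ends[of k] by simp
next
  case (H i s)
  have 4: "card {H i a, H i b, H i c, H i d} = 4"
    if "a \<noteq> b" "a \<noteq> c" "a \<noteq> d" "b \<noteq> c" "b \<noteq> d" "c \<noteq> d" for a b c d
    using that by simp
  obtain n where n: "m = n + 5" using m by (metis le_Suc_ex add.commute)
  have "s \<le> n + 5" using u H n by simp
  then show ?thesis by (cases rule: strand_index_cases) (use H n 4 in simp_all)
qed

lemma regular_chord_graph:
  assumes "m \<ge> 5"
  shows "regular 4 (chord_graph m)"
  unfolding regular_def
proof
  fix u assume u: "u \<in> pverts (chord_graph m)"
  have "out_arcs (with_proj (chord_graph m)) u = Pair u ` nbhd m u"
    using parcs_chord_graph[OF assms u] by (auto simp: out_arcs_def)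
  then show "out_degree (with_proj (chord_graph m)) u = 4"
    using card_nbhd[OF assms u] by (simp add: out_degree_def card_image inj_on_def)
qed

section \<open>The graphs are not realizable\<close>

locale chord_realization = realization "chord_graph m" \<C> f g for m \<C> f g +
  assumes m: "m \<ge> 5"
begin

abbreviation "V \<equiv> pverts (chord_graph m)"
abbreviation "E \<equiv> parcs (chord_graph m)"

lemma arcs_iff: "u \<in> V \<Longrightarrow> (u, v) \<in> E \<longleftrightarrow> v \<in> nbhd m u"
  by (rule parcs_chord_graph[OF m])

lemma nbrs_subset: "u \<in> V \<Longrightarrow> nbrs c u \<subseteq> nbhd m u"
  by (auto simp: nbrs_def arcs_iff)

lemma nbrs_disjoint: "c \<noteq> d \<Longrightarrow> nbrs c u \<inter> nbrs d u = {}"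
  by (auto simp: nbrs_def)

lemma other_nbr:
  assumes "x \<in> nbrs c u"
  obtains y where "y \<in> nbrs c u" "y \<noteq> x"
proof -
  have "(u, x) \<in> E" "circle_of {u, x} = c" using assms by (auto simp: nbrs_def)
  then have "card (nbrs c u) = 2"
    using circle_of(1)[OF uedgesI] end_on_circle wellformed' by (intro card_nbrs) auto
  then have "\<not> nbrs c u \<subseteq> {x}" using card_mono[of "{x}" "nbrs c u"] by auto
  then show thesis using that by auto
qed

lemma strand_arcs:
  assumes "i < 8"
  shows "(X i, Z (chord i)) \<in> E" "(X i, H i 0) \<in> E" "(Z (chord i), X i) \<in> E" "(Z (chord i), H i m) \<in> E"
  using assms direct[of i m] enter[of i m] leave[of i m] by (auto simp: parcs_iff)

lemma strand_circle:
  assumes i: "i < 8"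
  shows "circle_of {X i, H i 0} = circle_of {Z (chord i), H i m}"
proof -
  \<comment> \<open>Only the first and the last place of a strand have a neighbour outside
    it.\<close>
  have cut: "{(u, w) \<in> E. u \<in> H i ` {..m} \<and> w \<notin> H i ` {..m}} = {(H i 0, X i), (H i m, Z (chord i))}"
  proof
    show "{(u, w) \<in> E. u \<in> H i ` {..m} \<and> w \<notin> H i ` {..m}} \<subseteq> {(H i 0, X i), (H i m, Z (chord i))}"
    proof
      fix e assume "e \<in> {(u, w) \<in> E. u \<in> H i ` {..m} \<and> w \<notin> H i ` {..m}}"
      then obtain s w where s: "e = (H i s, w)" "s \<le> m" "w \<notin> H i ` {..m}" "(H i s, w) \<in> E" by auto
      then have "w \<in> nbhd m (H i s)" using arcs_iff[of "H i s" w] i by simp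
      moreover have "w \<noteq> H i t" if "t \<le> m" for t using s(3) that by auto
      ultimately have "s = 0 \<and> w = X i \<or> s = m \<and> w = Z (chord i)"
        using m s(2) by (auto split: if_splits)
      then show "e \<in> {(H i 0, X i), (H i m, Z (chord i))}" using s by auto
    qed
    show "{(H i 0, X i), (H i m, Z (chord i))} \<subseteq> {(u, w) \<in> E. u \<in> H i ` {..m} \<and> w \<notin> H i ` {..m}}"
      using arcs_symmetric[OF strand_arcs(2)[OF i]] arcs_symmetric[OF strand_arcs(4)[OF i]] by auto
  qed
  have "circle_of {H i 0, X i} = circle_of {H i m, Z (chord i)}"
    by (rule two_edge_cut_same_circle[OF _ _ cut]) (use i in auto)
  then show ?thesis by (simp only: insert_commute)
qed

definition D :: "nat \<Rightarrow> complex set" where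
  "D i = circle_of {X i, Z (chord i)}"

lemma D_on:
  assumes "i < 8"
  shows "D i \<in> \<C>" "f (X i) \<in> D i" "f (Z (chord i)) \<in> D i"
  using circle_of(1)[OF uedgesI[OF strand_arcs(1)[OF assms]]] end_on_circle[OF strand_arcs(1)[OF assms]]
  by (simp_all add: D_def)

text \<open>A circle that leaves the middle vertex towards \<open>j\<close> reaches
  \<open>X j\<close> in either case: along the edge at once, along the strand because the circle at
  one end of a strand is also the one at the other end.\<close>

lemma X_on_circle:
  assumes j: "j < 8" and y: "y \<in> nbrs c (Z (chord j))" "y = X j \<or> y = H j m"
  shows "f (X j) \<in> c"
  using y(2)
proof
  assume "y = X j"
  then show ?thesis using y(1) end_on_circle[OF strand_arcs(3)[OF j]] by (auto simp: nbrs_def)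
next
  assume "y = H j m"
  then have "c = circle_of {X j, H j 0}" using y(1) strand_circle[OF j] by (simp add: nbrs_def)
  then show ?thesis using end_on_circle[OF strand_arcs(2)[OF j]] by simp
qed

text \<open>Otherwise two circles would share both ends of the chord and its middle vertex.\<close>
lemma strand_on_D:
  assumes i: "i < 8"
  shows "circle_of {X i, H i 0} = D i"
proof (rule ccontr)
  let ?b = "circle_of {X i, H i 0}" and ?z = "Z (chord i)"
  assume ne: "?b \<noteq> D i"
  note k = chord_less[OF i]
  obtain j where j: "j < 8" "j \<noteq> i" "chord j = chord i"
    and nb: "nbhd m ?z = {X i, X j, H i m, H j m}"
  proof (cases "i = chord_end (chord i)")
    case True
    then show thesis using that[of "chord_end' (chord i)"] chord_ends[OF k] by auto
  next
    case False
    then have "i = chord_end' (chord i)" using chord_eq_iff[OF i k] by auto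
    then show thesis using that[of "chord_end (chord i)"] chord_ends[OF k] by auto
  qed
  have z: "?z \<in> V" using k by simp
  have a: "X i \<in> nbrs (D i) ?z"
    using strand_arcs(3)[OF i] by (simp add: nbrs_def D_def insert_commute)
  have b: "H i m \<in> nbrs ?b ?z"
    using strand_arcs(4)[OF i] strand_circle[OF i] by (simp add: nbrs_def)
  have disj: "nbrs (D i) ?z \<inter> nbrs ?b ?z = {}" using nbrs_disjoint ne by auto
  \<comment> \<open>The circle of the edge cannot go on from \<open>?z\<close> into the strand of
    \<open>i\<close>, which starts on another circle, so it goes on towards the other end
    \<open>X j\<close>. Symmetrically, the circle of the strand cannot go on along the edge and
    reaches \<open>X j\<close> as well.\<close>
  obtain y where y: "y \<in> nbrs (D i) ?z" "y \<noteq> X i" using other_nbr[OF a] by blast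
  have "y \<in> {X i, X j, H i m, H j m}" using nbrs_subset[OF z] nb y by auto
  moreover have "y \<noteq> H i m" using disj b y by auto
  ultimately have "y = X j \<or> y = H j m" using y by auto
  then have Da: "f (X j) \<in> D i" using X_on_circle[OF j(1)] j(3) y by simp
  obtain y' where y': "y' \<in> nbrs ?b ?z" "y' \<noteq> H i m" using other_nbr[OF b] by blast
  have "y' \<in> {X i, X j, H i m, H j m}" using nbrs_subset[OF z] nb y' by auto
  moreover have "y' \<noteq> X i" using disj a y' by auto
  ultimately have "y' = X j \<or> y' = H j m" using y' by auto
  then have "f (X j) \<in> ?b" using X_on_circle[OF j(1)] j(3) y' by simp
  moreover have "f ?z \<in> ?b" using b end_on_circle[OF strand_arcs(4)[OF i]] by (auto simp: nbrs_def)
  moreover have "f (X i) \<in> ?b" using end_on_circle[OF strand_arcs(2)[OF i]] by auto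
  moreover have "?b \<in> \<C>" using circle_of(1)[OF uedgesI[OF strand_arcs(2)[OF i]]] .
  ultimately have "?b = D i"
    using Da D_on[OF i] i j k by (intro circles_share_three[of ?b "D i" "X i" "X j" ?z]) auto
  then show False using ne by simp
qed

lemma nbrs_D:
  assumes i: "i < 8"
  shows "nbrs (D i) (X i) = {Z (chord i), H i 0}" "nbrs (D i) (Z (chord i)) = {X i, H i m}"
proof -
  show "nbrs (D i) (X i) = {Z (chord i), H i 0}"
    by (rule nbrs_eqI) (use strand_arcs[OF i] strand_on_D[OF i] in \<open>auto simp: nbrs_def D_def\<close>)
  have "circle_of {Z (chord i), X i} = D i" by (simp add: D_def insert_commute)
  then show "nbrs (D i) (Z (chord i)) = {X i, H i m}"
    using strand_arcs[OF i] strand_on_D[OF i] strand_circle[OF i]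
    by (intro nbrs_eqI) (auto simp: nbrs_def)
qed

definition C :: "complex set" where
  "C = circle_of {X 0, X 1}"

lemma rim_arcs:
  assumes "i < 8"
  shows "(X i, X (Suc i mod 8)) \<in> E" "(X i, X ((i + 7) mod 8)) \<in> E"
  using arcs_iff[of "X i"] assms by simp_all

text \<open>Two of the four edges at \<open>X i\<close> are used up by \<open>D i\<close>, so a
  circle that arrives along the rim has to leave along the rim.\<close>

lemma nbrs_rim:
  assumes i: "i < 8"
  shows "nbrs (circle_of {X i, X (Suc i mod 8)}) (X i) = {X (Suc i mod 8), X ((i + 7) mod 8)}"
proof -
  let ?c = "circle_of {X i, X (Suc i mod 8)}"
  have x: "X (Suc i mod 8) \<in> nbrs ?c (X i)" using rim_arcs[OF i] by (simp add: nbrs_def)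
  then have "?c \<noteq> D i" using nbrs_D(1)[OF i] by auto
  then have disj: "nbrs ?c (X i) \<inter> {Z (chord i), H i 0} = {}" using nbrs_disjoint nbrs_D(1)[OF i] by blast
  obtain y where y: "y \<in> nbrs ?c (X i)" "y \<noteq> X (Suc i mod 8)" using other_nbr[OF x] by blast
  then have "y = X ((i + 7) mod 8)" using nbrs_subset[of "X i" ?c] disj i by auto
  then show ?thesis using nbrs_eqI[of "X (Suc i mod 8)" y ?c "X i"] x y by auto
qed

lemma circle_of_rim:
  assumes "i < 8"
  shows "circle_of {X i, X (Suc i mod 8)} = C"
  using assms
proof (induction i)
  case 0
  then show ?case by (simp add: C_def)
next
  case (Suc i)
  then have "X ((Suc i + 7) mod 8) \<in> nbrs (circle_of {X (Suc i), X (Suc (Suc i) mod 8)}) (X (Suc i))"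
    using nbrs_rim[of "Suc i"] by simp
  moreover have "(Suc i + 7) mod 8 = i" "Suc i mod 8 = Suc i" using Suc.prems by auto
  ultimately show ?case using Suc by (simp add: nbrs_def insert_commute)
qed

lemma nbrs_C: "i < 8 \<Longrightarrow> nbrs C (X i) = {X (Suc i mod 8), X ((i + 7) mod 8)}"
  using nbrs_rim[of i] circle_of_rim[of i] by simp

lemma C_on: "C \<in> \<C>" and X_on_C: "i < 8 \<Longrightarrow> f (X i) \<in> C"
proof -
  show "C \<in> \<C>" using circle_of(1)[OF uedgesI[OF rim_arcs(1)[of 0]]] by (simp add: C_def)
  show "f (X i) \<in> C" if "i < 8"
    using end_on_circle(1)[OF rim_arcs(1)[OF that]] circle_of_rim[OF that] by simp
qed

lemma verts_on_C:
  assumes "u \<in> V" "f u \<in> C"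
  shows "u \<in> X ` {..<8}"
proof (rule circle_subset_closed[OF C_on])
  show "f (X 0) \<in> C" by (rule X_on_C) simp
  show "nbrs C u \<subseteq> X ` {..<8}" if "u \<in> X ` {..<8}" for u using that nbrs_C by auto
qed (use assms in auto)

text \<open>At \<open>X i\<close> and at the middle vertex \<open>nbrs_D\<close> keeps the circle on
  the link, and between them every neighbour of a strand vertex belongs to the set.\<close>

lemma verts_on_D:
  assumes i: "i < 8" and u: "u \<in> V" "f u \<in> D i"
  shows "u \<in> {X i, Z (chord i)} \<union> H i ` {..m}" (is "u \<in> ?S")
proof (rule circle_subset_closed)
  show "nbrs (D i) u \<subseteq> ?S" if "u \<in> ?S" for u
  proof -
    have "nbrs (D i) (H i s) \<subseteq> ?S" if "s \<le> m" for s
      using nbrs_subset[of "H i s" "D i"] m i that by (auto split: if_splits)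
    then show ?thesis using that nbrs_D[OF i] by auto
  qed
  show "D i \<in> \<C>" "X i \<in> V" "f (X i) \<in> D i" "X i \<in> ?S" using D_on[OF i] i by auto
qed (use u in auto)

lemma common_vertex:
  assumes "c \<in> \<C>" "d \<in> \<C>" "c \<noteq> d" "x \<in> c" "x \<in> d"
  obtains u where "u \<in> V" "x = f u"
  using common_points[OF assms(1-3)] assms(4,5) P_eq by (metis IntI imageE subsetD)

lemma D_ne_C: "i < 8 \<Longrightarrow> D i \<noteq> C"
  using nbrs_D(1)[of i] nbrs_C[of i] by auto

lemma D_Int_C:
  assumes i: "i < 8"
  shows "C \<inter> D i = {f (X i)}"
proof -
  have "x = f (X i)" if x: "x \<in> C" "x \<in> D i" for x
  proof -
    obtain u where u: "u \<in> V" "x = f u"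
      using common_vertex[OF C_on D_on(1)[OF i]] D_ne_C[OF i] x by metis
    then have "u \<in> X ` {..<8}" "u \<in> {X i, Z (chord i)} \<union> H i ` {..m}"
      using verts_on_C verts_on_D[OF i] x by auto
    then show ?thesis using u by auto
  qed
  moreover have "f (X i) \<in> C \<inter> D i" using X_on_C[OF i] D_on(2)[OF i] by simp
  ultimately show ?thesis by blast
qed

lemma D_Int_D:
  assumes "i < 8" "j < 8" "chord i \<noteq> chord j"
  shows "D i \<inter> D j = {}"
proof -
  have "i \<noteq> j" using assms by auto
  have ne: "D i \<noteq> D j"
  proof
    assume "D i = D j"
    then have "X j \<in> {X i, Z (chord i)} \<union> H i ` {..m}"
      using verts_on_D[OF assms(1), of "X j"] D_on[OF assms(2)] assms by simp
    then show False using \<open>i \<noteq> j\<close> by auto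
  qed
  have False if x: "x \<in> D i" "x \<in> D j" for x
  proof -
    obtain u where u: "u \<in> V" "x = f u"
      using common_vertex[OF D_on(1)[OF assms(1)] D_on(1)[OF assms(2)] ne x] by metis
    then have "u \<in> {X i, Z (chord i)} \<union> H i ` {..m}" "u \<in> {X j, Z (chord j)} \<union> H j ` {..m}"
      using verts_on_D[OF assms(1)] verts_on_D[OF assms(2)] x by auto
    then show ?thesis using assms \<open>i \<noteq> j\<close> by auto
  qed
  then show ?thesis by auto
qed

text \<open>The circuit of \<open>C\<close> goes from \<open>X 0\<close> to \<open>X 1\<close> or to
  \<open>X 7\<close> and never turns back, so its first step decides the sense of the whole run;
  this is \<epsilon>.\<close>

lemma rim_angles:
  obtains z R t \<epsilon> where "R > 0" "C = sphere z R" "\<epsilon>\<^sup>2 = (1::real)"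
    "\<forall>i<8. f (X i) = on_circle z R (t i)"
    "\<forall>i j. i < j \<longrightarrow> j < 8 \<longrightarrow> \<epsilon> * t i < \<epsilon> * t j \<and> \<epsilon> * t j < \<epsilon> * t i + 2 * pi"
proof -
  have X0: "X 0 \<in> V" "f (X 0) \<in> C" using X_on_C by auto
  obtain R z M t q where R: "R > 0" "C = sphere z R" and M: "M \<ge> 3"
    and mono: "strict_mono_on {..M} t" and t: "t M = t 0 + 2 * pi" and q: "q 0 = X 0" "q M = X 0"
    and fq: "\<forall>i\<le>M. f (q i) = on_circle z R (t i)"
    and inj: "inj_on q {..<M}" and "q ` {..<M} = {u \<in> V. f u \<in> C}"
    and e: "\<forall>u w. (u, w) \<in> E \<and> circle_of {u, w} = C \<longleftrightarrow> (\<exists>i<M. {u, w} = {q i, q (Suc i)})"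
    by (rule circuit[OF C_on X0])
  have less: "t i < t j" if "i < j" "j \<le> M" for i j
    using strict_mono_onD[OF mono, of i j] that by auto
  have step: "q (Suc k) \<in> nbrs C (q k)" if "k < M" for k
  proof -
    have "\<exists>j<M. {q k, q (Suc k)} = {q j, q (Suc j)}" using that by (intro exI[of _ k]) simp
    then show ?thesis using e by (simp add: nbrs_def)
  qed
  have turn: "q (Suc (Suc k)) \<noteq> q k" if "Suc (Suc k) \<le> M" for k
  proof (cases "Suc (Suc k) = M")
    case True
    then show ?thesis using inj_onD[OF inj, of 0 k] M q by auto
  next
    case False
    then show ?thesis using inj_onD[OF inj, of "Suc (Suc k)" k] that by auto
  qed
  have "q 1 = X 1 \<or> q 1 = X 7" using step[of 0] M q nbrs_C[of 0] by auto
  then show thesis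
  proof
    assume q1: "q 1 = X 1"
    have qX: "q k = X k" if "k \<le> M" "k \<le> 7" for k
      using that
    proof (induction k rule: less_induct)
      case (less k)
      show ?case
      proof (cases "k \<le> 1")
        case True
        then show ?thesis using q q1 by (cases k) auto
      next
        case False
        then obtain l where l: "k = Suc (Suc l)" by (metis One_nat_def not_less_eq_eq Suc_le_D)
        then have "q l = X l" "q (Suc l) = X (Suc l)" using less by auto
        moreover have "(Suc l + 7) mod 8 = l" "Suc (Suc l) mod 8 = k" using l less.prems by auto
        ultimately show ?thesis
          using step[of "Suc l"] turn[of l] nbrs_C[of "Suc l"] l less.prems by auto
      qed
    qed
    \<comment> \<open>The circuit is back at \<open>X 0\<close> at index \<open>M\<close>, whereas
      the indices 1 to 7 belong to other rim vertices.\<close>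
    have "M \<ge> 8" using qX[of M] M q by (cases "M \<le> 7") auto
    show thesis
    proof (rule that[of R z 1 t])
      show "\<forall>i<8. f (X i) = on_circle z R (t i)"
      proof (intro allI impI)
        fix i :: nat assume "i < 8"
        then show "f (X i) = on_circle z R (t i)"
          using qX[of i] fq[rule_format, of i] \<open>M \<ge> 8\<close> by simp
      qed
      show "\<forall>i j. i < j \<longrightarrow> j < 8 \<longrightarrow> 1 * t i < 1 * t j \<and> 1 * t j < 1 * t i + 2 * pi"
      proof (intro allI impI)
        fix i j :: nat assume "i < j" "j < 8"
        then show "1 * t i < 1 * t j \<and> 1 * t j < 1 * t i + 2 * pi"
          using less[of i j] less[of j M] less[of 0 i] t \<open>M \<ge> 8\<close> by (cases "i = 0") auto
      qed
    qed (use R in auto)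
  next
    assume q1: "q 1 = X 7"
    have qX: "q k = X ((8 - k) mod 8)" if "k \<le> M" "k \<le> 7" for k
      using that
    proof (induction k rule: less_induct)
      case (less k)
      show ?case
      proof (cases "k \<le> 1")
        case True
        then show ?thesis using q q1 by (cases k) auto
      next
        case False
        then obtain l where l: "k = Suc (Suc l)" by (metis One_nat_def not_less_eq_eq Suc_le_D)
        then have "q l = X ((8 - l) mod 8)" "q (Suc l) = X (7 - l)" using less by auto
        moreover have "Suc (7 - l) mod 8 = (8 - l) mod 8" "(7 - l + 7) mod 8 = 6 - l"
          using l less.prems by (auto simp: mod_if)
        ultimately have "q k = X (6 - l)"
          using step[of "Suc l"] turn[of l] nbrs_C[of "7 - l"] l less.prems by auto
        moreover have "(8 - k) mod 8 = 6 - l" using l less.prems by simp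
        ultimately show ?thesis by (simp only:)
      qed
    qed
    have "M \<ge> 8" using qX[of M] M q by (cases "M \<le> 7") auto
    \<comment> \<open>\<open>X 0\<close> receives the angle at the end of the turn instead of the
      one at its beginning, so that \<open>t'\<close> decreases from index 0 on.\<close>
    define t' where "t' i = (if i = 0 then t M else t (8 - i))" for i
    show thesis
    proof (rule that[of R z "-1" t'])
      show "\<forall>i<8. f (X i) = on_circle z R (t' i)"
      proof (intro allI impI)
        fix i :: nat assume "i < 8"
        then show "f (X i) = on_circle z R (t' i)"
          using qX[of "8 - i"] fq[rule_format, of "8 - i"] fq[rule_format, of M] q \<open>M \<ge> 8\<close>
          by (cases "i = 0") (auto simp: t'_def)
      qed
      show "\<forall>i j. i < j \<longrightarrow> j < 8 \<longrightarrow> - 1 * t' i < - 1 * t' j \<and> - 1 * t' j < - 1 * t' i + 2 * pi"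
      proof (intro allI impI)
        fix i j :: nat assume ij: "i < j" "j < 8"
        then have "t' j < t' i" using less[of "8 - j" "8 - i"] less[of "8 - j" M] \<open>M \<ge> 8\<close>
          by (auto simp: t'_def)
        moreover have "8 - i < M" if "i \<noteq> 0" using that \<open>M \<ge> 8\<close> by linarith
        then have "t' i \<le> t 0 + 2 * pi" using less[of "8 - i" M] t by (cases "i = 0") (auto simp: t'_def)
        moreover have "t 0 < t' j" using less[of 0 "8 - j"] ij \<open>M \<ge> 8\<close> by (auto simp: t'_def)
        ultimately show "- 1 * t' i < - 1 * t' j \<and> - 1 * t' j < - 1 * t' i + 2 * pi" by simp
      qed
    qed (use R in auto)
  qed
qed

lemma no_realization: False
proof -
  obtain z R t \<epsilon> where R: "R > 0" "C = sphere z R" and \<epsilon>: "\<epsilon>\<^sup>2 = (1::real)"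
    and t: "\<forall>i<8. f (X i) = on_circle z R (t i)"
    and order: "\<forall>i j. i < j \<longrightarrow> j < 8 \<longrightarrow> \<epsilon> * t i < \<epsilon> * t j \<and> \<epsilon> * t j < \<epsilon> * t i + 2 * pi"
    by (rule rim_angles)
  show False
  proof (rule no_tangent_octet[OF R(1) _ _ \<epsilon>])
    fix i :: nat assume i: "i < 8"
    show "\<exists>w r. r > 0 \<and> D i = sphere w r" using circleE[OF D_on(1)[OF i]] by metis
    show "sphere z R \<inter> D i = {z + of_real R * cis (t i)}"
      using D_Int_C[OF i] t i R by (simp add: on_circle_def)
  next
    fix i j :: nat assume "i < j" "j < 8"
    then show "\<epsilon> * t i < \<epsilon> * t j \<and> \<epsilon> * t j < \<epsilon> * t i + 2 * pi" using order by blast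
  next
    fix i j :: nat assume "(i, j) \<in> {(1, 4), (3, 6), (0, 5), (2, 7)}"
    then have "i < 8" "j < 8" "chord i = chord j" by (auto simp: chord_def)
    then show "D i \<inter> D j \<noteq> {}" using D_on(3)[of i] D_on(3)[of j] by auto
  next
    fix i j :: nat assume ij: "i < j" "j < 8" and "(i, j) \<notin> {(1, 4), (3, 6), (0, 5), (2, 7)}"
    moreover from ij have "i < 8" by simp
    ultimately have "chord i \<noteq> chord j"
      unfolding less_8_iff by (elim disjE; simp add: chord_def)
    then show "D i \<inter> D j = {}" using D_Int_D ij by simp
  qed
qed

end

lemma not_circle_realizable_chord_graph:
  assumes "m \<ge> 5"
  shows "\<not> circle_realizable (chord_graph m)"
proof
  assume "circle_realizable (chord_graph m)"
  then obtain \<C> f g where "circle_system \<C>" "bij_betw f (pverts (chord_graph m)) (system_points \<C>)"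
    "bij_betw g (uedges (chord_graph m)) (system_arcs \<C>)"
    "\<forall>e \<in> uedges (chord_graph m). arc_ends (g e) = f ` e"
    unfolding circle_realizable_def realizes_def by blast
  then have "chord_realization m \<C> f g"
    using assms pair_graph_chord_graph[OF assms]
    by (intro chord_realization.intro realization.intro realization_axioms.intro chord_realization_axioms.intro) auto
  then show False by (rule chord_realization.no_realization)
qed

section \<open>Planarity\<close>

text \<open>Degree at least 3 turns faults at vertices into faults of edge pairs: two vertices at
  the same point would have disjoint edges that meet there, and a vertex on a foreign edge would
  have an edge of its own that meets this edge away from any common end.\<close>

lemma planar_straight:
  fixes p :: "'a \<Rightarrow> complex"
  assumes G: "pair_graph G" and B: "parcs G = B \<union> B\<inverse>"
    and deg: "\<And>v. v \<in> pverts G \<Longrightarrow> card {w. (v, w) \<in> parcs G} \<ge> 3"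
    and seg: "\<And>u v u' v'. (u, v) \<in> B \<Longrightarrow> (u', v') \<in> B \<Longrightarrow> {u, v} \<noteq> {u', v'} \<Longrightarrow>
      closed_segment (p u) (p v) \<inter> closed_segment (p u') (p v') \<subseteq> p ` ({u, v} \<inter> {u', v'})"
  shows "planar G"
proof -
  interpret pair_graph G by fact
  have segs: "closed_segment (p u) (p v) \<inter> closed_segment (p u') (p v') \<subseteq> p ` ({u, v} \<inter> {u', v'})"
    if "(u, v) \<in> parcs G" "(u', v') \<in> parcs G" "{u, v} \<noteq> {u', v'}" for u v u' v'
    using that B seg[of u v u' v'] seg[of v u u' v'] seg[of u v v' u'] seg[of v u v' u']
    by (auto simp: closed_segment_commute insert_commute)
  have other: "\<exists>w. (v, w) \<in> parcs G \<and> w \<notin> S" if v: "v \<in> pverts G" and S: "finite S" "card S \<le> 2" for v S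
  proof (rule ccontr)
    assume "\<not> ?thesis"
    then have "{w. (v, w) \<in> parcs G} \<subseteq> S" by auto
    then have "card {w. (v, w) \<in> parcs G} \<le> 2" using card_mono[of S] S by (meson order_trans)
    then show False using deg[OF v] by simp
  qed
  have inj: "u = v" if uv: "u \<in> pverts G" "v \<in> pverts G" "p u = p v" for u v
  proof (rule ccontr)
    assume "u \<noteq> v"
    obtain a where a: "(u, a) \<in> parcs G" "a \<noteq> v" using other[OF uv(1), of "{v}"] by auto
    have "card {u, a} \<le> 2" by (simp add: card_insert_if)
    then obtain b where b: "(v, b) \<in> parcs G" "b \<notin> {u, a}" using other[OF uv(2), of "{u, a}"] by blast
    have "p u \<in> closed_segment (p u) (p a) \<inter> closed_segment (p v) (p b)" using uv(3) by simp
    moreover have "{u, a} \<inter> {v, b} = {}" using a b \<open>u \<noteq> v\<close> by auto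
    ultimately show False using segs[OF a(1) b(1)] \<open>u \<noteq> v\<close> by auto
  qed
  have vert: "w \<in> {u, v}" if uv: "(u, v) \<in> parcs G" and w: "w \<in> pverts G" "p w \<in> closed_segment (p u) (p v)" for u v w
  proof (rule ccontr)
    assume nw: "w \<notin> {u, v}"
    obtain x where x: "(w, x) \<in> parcs G" using other[OF w(1), of "{}"] by auto
    have "p w \<in> closed_segment (p u) (p v) \<inter> closed_segment (p w) (p x)" using w by simp
    then obtain y where "y \<in> {u, v} \<inter> {w, x}" "p w = p y" using segs[OF uv x] nw by auto
    then show False using inj[of w y] w uv wellformed' nw by auto
  qed
  have "\<forall>e \<in> uedges G. \<exists>u v. e = {u, v} \<and> (u, v) \<in> parcs G" by (auto simp: uedges_def)
  then obtain a b where ab: "\<And>e. e \<in> uedges G \<Longrightarrow> e = {a e, b e} \<and> (a e, b e) \<in> parcs G" by metis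
  define \<gamma> where "\<gamma> e = linepath (p (a e)) (p (b e))" for e
  have im: "path_image (\<gamma> e) = closed_segment (p (a e)) (p (b e))" for e by (simp add: \<gamma>_def)
  have "plane_drawing G p \<gamma>"
    unfolding plane_drawing_def
  proof (intro conjI ballI impI)
    show "inj_on p (pverts G)" using inj by (auto simp: inj_on_def)
  next
    fix e assume e: "e \<in> uedges G"
    then have "a e \<in> pverts G" "b e \<in> pverts G" "a e \<noteq> b e"
      using ab[OF e] wellformed' no_loops' by blast+
    then have "p (a e) \<noteq> p (b e)" using inj by blast
    then show "Path_Connected.arc (\<gamma> e)" by (simp add: \<gamma>_def arc_linepath)
    have "{pathstart (\<gamma> e), pathfinish (\<gamma> e)} = p ` {a e, b e}" by (simp add: \<gamma>_def)
    then show "{pathstart (\<gamma> e), pathfinish (\<gamma> e)} = p ` e" using ab[OF e] by metis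
    have "path_image (\<gamma> e) \<inter> p ` pverts G = p ` {a e, b e}"
      unfolding im using vert[OF ab[OF e, THEN conjunct2]] \<open>a e \<in> pverts G\<close> \<open>b e \<in> pverts G\<close> by auto
    then show "path_image (\<gamma> e) \<inter> p ` pverts G = p ` e" using ab[OF e] by metis
  next
    fix e f assume e: "e \<in> uedges G" and f: "f \<in> uedges G" and "e \<noteq> f"
    have "path_image (\<gamma> e) \<inter> path_image (\<gamma> f) \<subseteq> p ` (e \<inter> f)"
      unfolding im using segs[of "a e" "b e" "a f" "b f"] ab[OF e] ab[OF f] \<open>e \<noteq> f\<close> by metis
    moreover have "p ` e \<subseteq> path_image (\<gamma> e)" if "e \<in> uedges G" for e
    proof -
      have "p ` {a e, b e} \<subseteq> path_image (\<gamma> e)" unfolding im by simp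
      then show ?thesis using ab[OF that] by metis
    qed
    ultimately show "path_image (\<gamma> e) \<inter> path_image (\<gamma> f) = p ` (e \<inter> f)" using e f by blast
  qed
  then show ?thesis by (auto simp: planar_def)
qed

section \<open>Separation of segments by linear functionals\<close>

lemma closed_segments_disjoint:
  fixes F :: "complex \<Rightarrow> real"
  assumes "linear F" "F a < F c" "F a < F d" "F b < F c" "F b < F d"
  shows "closed_segment a b \<inter> closed_segment c d = {}"
proof -
  have "F x \<le> max (F a) (F b)" if "x \<in> closed_segment a b" for x
  proof -
    have "F x \<in> closed_segment (F a) (F b)"
      using that closed_segment_linear_image[OF assms(1)] by blast
    then show ?thesis by (auto simp: closed_segment_eq_real_ivl split: if_splits)
  qed
  moreover have "F x \<ge> min (F c) (F d)" if "x \<in> closed_segment c d" for x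
  proof -
    have "F x \<in> closed_segment (F c) (F d)"
      using that closed_segment_linear_image[OF assms(1)] by blast
    then show ?thesis by (auto simp: closed_segment_eq_real_ivl split: if_splits)
  qed
  ultimately show ?thesis using assms by force
qed

text \<open>\<open>F c\<close> is an upper bound of \<open>F\<close> on the first segment and is
  attained on the second one only at \<open>c\<close>.\<close>

lemma closed_segments_touch:
  fixes F :: "complex \<Rightarrow> real"
  assumes "linear F" "F a \<le> F c" "F b \<le> F c" "F c < F d"
  shows "closed_segment a b \<inter> closed_segment c d \<subseteq> {c}"
proof
  fix x assume x: "x \<in> closed_segment a b \<inter> closed_segment c d"
  then have "F x \<in> closed_segment (F a) (F b)"
    using closed_segment_linear_image[OF assms(1)] by blast
  then have le: "F x \<le> F c" using assms by (auto simp: closed_segment_eq_real_ivl split: if_splits)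
  obtain u where u: "0 \<le> u" "u \<le> 1" "x = (1 - u) *\<^sub>R c + u *\<^sub>R d"
    using x by (auto simp: closed_segment_def)
  have "F x = (1 - u) * F c + u * F d"
    using assms(1) unfolding u(3) by (simp add: linear_add linear_scale)
  then have "u * (F d - F c) \<le> 0" using le by (simp add: algebra_simps)
  then have "u = 0" using u(1) assms(4) by (simp add: mult_le_0_iff)
  then show "x \<in> {c}" using u by simp
qed

lemma closed_segments_noncollinear:
  fixes a b d :: complex
  assumes "(Re b - Re a) * (Im d - Im a) \<noteq> (Im b - Im a) * (Re d - Re a)"
  shows "closed_segment a b \<inter> closed_segment a d \<subseteq> {a}"
proof
  fix x assume x: "x \<in> closed_segment a b \<inter> closed_segment a d"
  obtain u where u: "x = (1 - u) *\<^sub>R a + u *\<^sub>R b" using x by (auto simp: closed_segment_def)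
  obtain v where v: "x = (1 - v) *\<^sub>R a + v *\<^sub>R d" using x by (auto simp: closed_segment_def)
  have "u * (Re b - Re a) = v * (Re d - Re a)" "u * (Im b - Im a) = v * (Im d - Im a)"
    using arg_cong[OF u, of Re] arg_cong[OF v, of Re] arg_cong[OF u, of Im] arg_cong[OF v, of Im]
    by (simp_all add: algebra_simps)
  then have "v * ((Re b - Re a) * (Im d - Im a) - (Im b - Im a) * (Re d - Re a)) = 0" by algebra
  then have "v = 0" using assms by simp
  then show "x \<in> {a}" using v by simp
qed

lemma linear_coords: "linear Re" "linear Im" "linear (\<lambda>z. - Re z)" "linear (\<lambda>z. - Im z)"
  by (auto intro!: linearI)

section \<open>Straight-line drawing of a single strand\<close>

text \<open>The even indices lie on a line above the odd ones; only the ends of the edges \<open>top\<close> and \<open>bottom\<close> are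
  moved outwards, so that these edges avoid the other vertices.\<close>
definition height :: "nat \<Rightarrow> nat \<Rightarrow> real" where
  "height m s = (if even s then if s = 0 \<or> s = m - 1 then 3 else 2 else if s = 1 \<or> s = m then 0 else 1)"

text \<open>Local coordinates, shared by all strands, so the indices of \<open>X\<close>,
  \<open>Z\<close> and the first index of \<open>H\<close> do not enter. The direct edge runs at
  height -1, below the strand, whose vertices have their place as abscissa.\<close>

fun loc :: "nat \<Rightarrow> vert \<Rightarrow> complex" where
  "loc m (X i) = Complex (-1) (-1)"
| "loc m (Z k) = Complex (real m + 1) (-1)"
| "loc m (H i s) = Complex (real s) (height m s)"

definition apart :: "nat \<Rightarrow> vert \<times> vert \<Rightarrow> vert \<times> vert \<Rightarrow> bool" where
  "apart m e f \<longleftrightarrow> closed_segment (loc m (fst e)) (loc m (snd e)) \<inter> closed_segment (loc m (fst f)) (loc m (snd f))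
     \<subseteq> loc m ` ({fst e, snd e} \<inter> {fst f, snd f})"

lemma apart_sym: "apart m e f \<longleftrightarrow> apart m f e"
  by (simp add: apart_def Int_commute)

lemma apart_swap: "apart m (u, v) f \<longleftrightarrow> apart m (v, u) f"
  by (simp add: apart_def closed_segment_commute insert_commute)

lemma apart_swap': "apart m e (u, v) \<longleftrightarrow> apart m e (v, u)"
  by (simp add: apart_def closed_segment_commute insert_commute)

lemma apartI:
  fixes F :: "complex \<Rightarrow> real"
  assumes "linear F"
    and "F (loc m u) < F (loc m u')" "F (loc m u) < F (loc m v')"
      "F (loc m v) < F (loc m u')" "F (loc m v) < F (loc m v')"
  shows "apart m (u, v) (u', v')"
  using closed_segments_disjoint[OF assms] by (simp add: apart_def)

lemma apart_touchI:
  fixes F :: "complex \<Rightarrow> real"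
  assumes "linear F" "c \<in> {u, v}"
    and "F (loc m u) \<le> F (loc m c)" "F (loc m v) \<le> F (loc m c)" "F (loc m c) < F (loc m d)"
  shows "apart m (u, v) (c, d)"
  using closed_segments_touch[OF assms(1,3-5)] assms(2) by (auto simp: apart_def)

lemma apart_noncollinearI:
  assumes "(Re (loc m b) - Re (loc m a)) * (Im (loc m d) - Im (loc m a))
      \<noteq> (Im (loc m b) - Im (loc m a)) * (Re (loc m d) - Re (loc m a))"
  shows "apart m (a, b) (a, d)"
  using closed_segments_noncollinear[OF assms] by (auto simp: apart_def)

context
  fixes m :: nat assumes m: "m \<ge> 5" "odd m"
begin

lemma height_even: "even s \<Longrightarrow> 2 \<le> height m s \<and> height m s \<le> 3"
  and height_odd: "odd s \<Longrightarrow> 0 \<le> height m s \<and> height m s \<le> 1"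
  by (auto simp: height_def)

lemma height_bounds: "0 \<le> height m s" "height m s \<le> 3"
  using height_even[of s] height_odd[of s] by (cases "even s"; simp)+

lemma height_ends: "height m 0 = 3" "height m (m - 1) = 3" "height m (Suc 0) = 0" "height m m = 0"
  using m by (auto simp: height_def)

lemma height_less: "s \<noteq> 0 \<Longrightarrow> s \<noteq> m - 1 \<Longrightarrow> height m s < 3"
  and height_pos: "s \<noteq> 1 \<Longrightarrow> s \<noteq> m \<Longrightarrow> height m s > 0"
  by (auto simp: height_def)

lemma apart_direct:
  "apart m (X i, Z k) (X i, H i s)"
  "apart m (X i, Z k) (H i s, Z k)"
  "apart m (X i, Z k) (H i s, H i t)"
proof -
  have h: "height m s > -1" for s using height_bounds(1)[of s] by linarith
  show "apart m (X i, Z k) (X i, H i s)"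
    by (rule apart_touchI[OF linear_coords(2)]) (use h in auto)
  show "apart m (X i, Z k) (H i s, Z k)"
    by (subst apart_swap', rule apart_touchI[OF linear_coords(2)]) (use h in auto)
  show "apart m (X i, Z k) (H i s, H i t)"
    by (rule apartI[OF linear_coords(2)]) (use h in auto)
qed

lemma apart_enter:
  "apart m (X i, H i 0) (H i m, Z k)"
  "s < t \<Longrightarrow> apart m (X i, H i 0) (H i s, H i t)"
proof -
  show "apart m (X i, H i 0) (H i m, Z k)"
    by (rule apartI[OF linear_coords(1)]) (use m in auto)
  show "apart m (X i, H i 0) (H i s, H i t)" if "s < t"
  proof (cases "s = 0")
    case True
    then show ?thesis using that by (intro apart_touchI[OF linear_coords(1)]) auto
  next
    case False
    then show ?thesis using that by (intro apartI[OF linear_coords(1)]) auto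
  qed
qed

lemma apart_leave:
  assumes "s < t" "t \<le> m"
  shows "apart m (H i m, Z k) (H i s, H i t)"
proof (cases "t = m")
  case True
  then show ?thesis
    using assms by (subst apart_swap', intro apart_touchI[OF linear_coords(3)]) auto
next
  case False
  then show ?thesis using assms
    by (subst apart_sym, intro apartI[OF linear_coords(1)]) auto
qed

text \<open>Height 3 is attained only at the two ends of this edge, so everything else on the strand
  lies below it.\<close>

lemma apart_top:
  assumes "s < t" "t \<le> s + 2" "t \<le> m"
  shows "apart m (H i 0, H i (m - 1)) (H i s, H i t)"
proof -
  \<comment> \<open>A step spans at most two places and thus cannot join both ends of the top
    edge.\<close>
  have "t \<noteq> m - 1" if "s = 0" using that assms m by linarith
  then consider "s = 0" "t \<noteq> m - 1" | "t = m - 1" "s \<noteq> 0" | "s = m - 1" | "s \<noteq> 0" "t \<noteq> 0" "s \<noteq> m - 1" "t \<noteq> m - 1"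
    using assms m by auto
  then show ?thesis
  proof cases
    case 1
    then show ?thesis using assms height_less[of t] height_ends
      by (intro apart_touchI[OF linear_coords(4)]) auto
  next
    case 2
    then show ?thesis using assms height_less[of s] height_ends
      by (subst apart_swap', intro apart_touchI[OF linear_coords(4)]) auto
  next
    case 3
    then show ?thesis using assms height_less[of t] height_ends
      by (intro apart_touchI[OF linear_coords(4)]) auto
  next
    case 4
    then show ?thesis using height_less[of s] height_less[of t] height_ends
      by (intro apartI[OF linear_coords(4)]) auto
  qed
qed

lemma apart_bottom:
  assumes "s < t" "t \<le> s + 2" "t \<le> m"
  shows "apart m (H i 1, H i m) (H i s, H i t)"
proof -
  consider "s = 1" "t \<noteq> m" | "t = 1" "s = 0" | "t = m" "s \<noteq> 1" "s \<noteq> m" | "s \<noteq> 1" "t \<noteq> 1" "s \<noteq> m" "t \<noteq> m"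
    using assms m by auto
  then show ?thesis
  proof cases
    case 1
    then show ?thesis using assms height_pos[of t] height_ends
      by (intro apart_touchI[OF linear_coords(2)]) auto
  next
    case 2
    then show ?thesis using height_ends
      by (subst apart_swap', intro apart_touchI[OF linear_coords(2)]) auto
  next
    case 3
    then show ?thesis using height_pos[of s] height_ends
      by (subst apart_swap', intro apart_touchI[OF linear_coords(2)]) auto
  next
    case 4
    then show ?thesis using height_pos[of s] height_pos[of t] height_ends
      by (intro apartI[OF linear_coords(2)]) auto
  qed
qed

lemma apart_top_bottom: "apart m (H i 0, H i (m - 1)) (H i 1, H i m)"
  using height_ends by (intro apartI[OF linear_coords(4)]) auto

lemma apart_right:
  assumes "s < t" "t \<le> s'" "s' < t'"
  shows "apart m (H i s, H i t) (H i s', H i t')"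
proof (cases "t = s'")
  case True
  then show ?thesis using assms by (intro apart_touchI[OF linear_coords(1)]) auto
next
  case False
  then show ?thesis using assms by (intro apartI[OF linear_coords(1)]) auto
qed

text \<open>Even places have height at least 2 and odd ones at most 1, so a place is never level
  with the mean of its two neighbours. This settles a zigzag edge and a side that overlap
  horizontally from a common end, where coordinates do not separate.\<close>

lemma noncollinear: "height m s + height m (s + 2) \<noteq> 2 * height m (s + 1)"
  using height_even[of s] height_even[of "s + 2"] height_odd[of "s + 1"]
    height_odd[of s] height_odd[of "s + 2"] height_even[of "s + 1"]
  by (cases "even s") auto

lemma apart_zigzag_side:
  shows "apart m (H i s, H i (Suc s)) (H i t, H i (t + 2))"
proof -
  consider "t + 2 \<le> s" | "s = Suc t" | "s = t" | "Suc s \<le> t" by linarith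
  then show ?thesis
  proof cases
    case 1
    then show ?thesis by (subst apart_sym, intro apart_right) auto
  next
    case 2
    have "apart m (H i (t + 2), H i (t + 1)) (H i (t + 2), H i t)"
      by (rule apart_noncollinearI) (use noncollinear[of t] in \<open>auto simp: algebra_simps\<close>)
    then show ?thesis using 2 apart_swap apart_swap' by simp
  next
    case 3
    have "apart m (H i t, H i (t + 1)) (H i t, H i (t + 2))"
      by (rule apart_noncollinearI) (use noncollinear[of t] in \<open>auto simp: algebra_simps\<close>)
    then show ?thesis using 3 by simp
  next
    case 4
    then show ?thesis by (intro apart_right) auto
  qed
qed

text \<open>Two sides that overlap horizontally start at consecutive places, so they differ in
  parity and lie on different levels.\<close>

lemma apart_side_side:
  assumes "s < t"
  shows "apart m (H i s, H i (s + 2)) (H i t, H i (t + 2))"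
proof (cases "t = s + 1")
  case True
  show ?thesis
  proof (cases "even s")
    case even: True
    show ?thesis
      using True even height_even[of s] height_even[of "s + 2"] height_odd[of t] height_odd[of "t + 2"]
      by (intro apartI[OF linear_coords(4)]) auto
  next
    case odd: False
    then show ?thesis
      using True height_odd[of s] height_odd[of "s + 2"] height_even[of t] height_even[of "t + 2"]
      by (intro apartI[OF linear_coords(2)]) auto
  qed
next
  case False
  then show ?thesis using assms by (intro apart_right) auto
qed

lemma apart_steps:
  assumes "s < s'" "s' \<le> s + 2" "t < t'" "t' \<le> t + 2" "(s, s') \<noteq> (t, t')"
  shows "apart m (H i s, H i s') (H i t, H i t')"
proof -
  have s: "s' = Suc s \<or> s' = s + 2" and t: "t' = Suc t \<or> t' = t + 2" using assms by auto
  show ?thesis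
  proof (cases "s' = Suc s"; cases "t' = Suc t")
    assume "s' = Suc s" "t' = Suc t"
    then have "s' \<le> t \<or> t' \<le> s" using assms by auto
    then show ?thesis using apart_right[of s s' t t'] apart_right[of t t' s s'] assms apart_sym by metis
  next
    assume "s' = Suc s" "t' \<noteq> Suc t"
    then show ?thesis using apart_zigzag_side t by simp
  next
    assume "s' \<noteq> Suc s" "t' = Suc t"
    then show ?thesis using apart_zigzag_side[of i t s] s apart_sym by simp
  next
    assume "s' \<noteq> Suc s" "t' \<noteq> Suc t"
    then have "s' = s + 2" "t' = t + 2" using s t by auto
    moreover from this have "s < t \<or> t < s" using assms by auto
    ultimately show ?thesis using apart_side_side[of s t] apart_side_side[of t s] apart_sym by metis
  qed
qed

end

inductive_set strand :: "nat \<Rightarrow> nat \<Rightarrow> (vert \<times> vert) set" for m i where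
  s_direct: "(X i, Z (chord i)) \<in> strand m i"
| s_enter: "(X i, H i 0) \<in> strand m i"
| s_leave: "(H i m, Z (chord i)) \<in> strand m i"
| s_top: "(H i 0, H i (m - 1)) \<in> strand m i"
| s_bottom: "(H i 1, H i m) \<in> strand m i"
| s_step: "s < t \<Longrightarrow> t \<le> s + 2 \<Longrightarrow> t \<le> m \<Longrightarrow> (H i s, H i t) \<in> strand m i"

lemma strand_apart:
  assumes m: "m \<ge> 5" "odd m" and e: "(u, v) \<in> strand m i" and f: "(u', v') \<in> strand m i" and ne: "(u, v) \<noteq> (u', v')"
  shows "apart m (u, v) (u', v')"
proof -
  note sym = apart_sym[THEN iffD1]
  from e show ?thesis
  proof cases
    case s_direct
    from f show ?thesis by cases (use ne s_direct apart_direct[OF m] in simp_all)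
  next
    case s_enter
    from f show ?thesis
      by cases (use ne m s_enter sym[OF apart_direct(1)[OF m]] apart_enter[OF m] in simp_all)
  next
    case s_leave
    from f show ?thesis
      by cases (use ne m s_leave sym[OF apart_direct(2)[OF m]] sym[OF apart_enter(1)[OF m]] apart_leave[OF m] in simp_all)
  next
    case s_top
    from f show ?thesis
    proof cases
      case (s_step s t)
      then show ?thesis using s_top apart_top[OF m, of s t i] m by simp
    qed (use ne m s_top sym[OF apart_direct(3)[OF m]] sym[OF apart_enter(2)[OF m]]
        sym[OF apart_leave[OF m]] apart_top_bottom[OF m, of i] in simp_all)
  next
    case s_bottom
    from f show ?thesis
    proof cases
      case (s_step s t)
      then show ?thesis using s_bottom apart_bottom[OF m, of s t i] by simp
    next
      case s_top
      then show ?thesis using s_bottom sym[OF apart_top_bottom[OF m, of i]] by simp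
    qed (use ne m s_bottom sym[OF apart_direct(3)[OF m]] sym[OF apart_enter(2)[OF m]]
        sym[OF apart_leave[OF m]] in simp_all)
  next
    case (s_step s t)
    from f show ?thesis
    proof cases
      case s_top
      then show ?thesis using s_step sym[OF apart_top[OF m, of s t i]] m by simp
    next
      case s_bottom
      then show ?thesis using s_step sym[OF apart_bottom[OF m, of s t i]] by simp
    next
      case (s_step s' t')
      then show ?thesis using \<open>u = H i s\<close> \<open>v = H i t\<close> \<open>s < t\<close> \<open>t \<le> s + 2\<close> ne apart_steps[OF m, of s t s' t' i] by simp
    qed (use s_step sym[OF apart_direct(3)[OF m]] sym[OF apart_enter(2)[OF m]]
        sym[OF apart_leave[OF m]] in simp_all)
  qed
qed

section \<open>Assembling the strands along the rim\<close>

text \<open>\<open>X 1\<close> to \<open>X 6\<close> lie on the real axis, \<open>X 0\<close> and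
  \<open>X 7\<close> high above it. The middle vertices of chords 0 and 2 lie inside the rim above
  the axis, those of chords 1 and 3 below it; abscissa 8 lets chord 3 reach \<open>X 7\<close> on
  the right of the rim.\<close>

definition rim_pt :: "nat \<Rightarrow> complex" where
  "rim_pt i = [Complex 0 10, Complex 1 0, Complex 2 0, Complex 3 0, Complex 4 0, Complex 5 0, Complex 6 0, Complex 7 10] ! i"

definition hub_pt :: "nat \<Rightarrow> complex" where
  "hub_pt k = [Complex (5/2) 1, Complex (9/2) (-1), Complex 4 5, Complex 8 (-5)] ! k"

text \<open>A flat triangle erected over the direct edge, to contain one whole link; the height 1/10
  keeps different cells apart.\<close>

definition cell :: "nat \<Rightarrow> complex set" where
  "cell i = convex hull {rim_pt i, hub_pt (chord i), (rim_pt i + hub_pt (chord i)) / 2 + Complex 0 (1/10)}"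

lemma cellE:
  assumes "z \<in> cell i"
  obtains u v w where "u \<ge> 0" "v \<ge> 0" "w \<ge> 0" "u + v + w = 1"
    "Re z = u * Re (rim_pt i) + v * Re (hub_pt (chord i)) + w * ((Re (rim_pt i) + Re (hub_pt (chord i))) / 2)"
    "Im z = u * Im (rim_pt i) + v * Im (hub_pt (chord i)) + w * ((Im (rim_pt i) + Im (hub_pt (chord i))) / 2 + 1/10)"
  using assms unfolding cell_def convex_hull_3 by auto

text \<open>In barycentric coordinates each pair of cells yields a linear system with rational
  coefficients. It is unsolvable unless the hub is shared, and then it forces the weight
  \<open>v\<close> of the hub to be 1.\<close>

lemma cells_meet:
  assumes "i < j" "j < 8" "z \<in> cell i" "z \<in> cell j"
  shows "chord i = chord j \<and> z = hub_pt (chord i)"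
proof -
  obtain u v w where 1: "u \<ge> 0" "v \<ge> 0" "w \<ge> 0" "u + v + w = 1"
    "Re z = u * Re (rim_pt i) + v * Re (hub_pt (chord i)) + w * ((Re (rim_pt i) + Re (hub_pt (chord i))) / 2)"
    "Im z = u * Im (rim_pt i) + v * Im (hub_pt (chord i)) + w * ((Im (rim_pt i) + Im (hub_pt (chord i))) / 2 + 1/10)"
    using cellE[OF assms(3)] .
  obtain u' v' w' where 2: "u' \<ge> 0" "v' \<ge> 0" "w' \<ge> 0" "u' + v' + w' = 1"
    "Re z = u' * Re (rim_pt j) + v' * Re (hub_pt (chord j)) + w' * ((Re (rim_pt j) + Re (hub_pt (chord j))) / 2)"
    "Im z = u' * Im (rim_pt j) + v' * Im (hub_pt (chord j)) + w' * ((Im (rim_pt j) + Im (hub_pt (chord j))) / 2 + 1/10)"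
    using cellE[OF assms(4)] .
  have "i < 8" using assms by simp
  then have "chord i = chord j \<and> v = 1"
    using assms(1,2) 1 2 unfolding less_8_iff
    by (elim disjE; simp add: chord_def rim_pt_def hub_pt_def)
  moreover from this have "u = 0" "w = 0" using 1(1-4) by linarith+
  ultimately show ?thesis using 1 by (simp add: complex_eq_iff)
qed

lemma rim_meets_cell:
  assumes "i < 8" "j < 8" "z \<in> closed_segment (rim_pt i) (rim_pt (Suc i mod 8))" "z \<in> cell j"
  shows "(j = i \<or> j = Suc i mod 8) \<and> z = rim_pt j"
proof -
  obtain u v w where 1: "u \<ge> 0" "v \<ge> 0" "w \<ge> 0" "u + v + w = 1"
    "Re z = u * Re (rim_pt j) + v * Re (hub_pt (chord j)) + w * ((Re (rim_pt j) + Re (hub_pt (chord j))) / 2)"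
    "Im z = u * Im (rim_pt j) + v * Im (hub_pt (chord j)) + w * ((Im (rim_pt j) + Im (hub_pt (chord j))) / 2 + 1/10)"
    using cellE[OF assms(4)] .
  obtain t where 2: "0 \<le> t" "t \<le> 1"
    "Re z = (1 - t) * Re (rim_pt i) + t * Re (rim_pt (Suc i mod 8))"
    "Im z = (1 - t) * Im (rim_pt i) + t * Im (rim_pt (Suc i mod 8))"
    using assms(3) by (auto simp: closed_segment_def)
  have "(j = i \<or> j = Suc i mod 8) \<and> u = 1"
    using assms(1,2) 1 2 unfolding less_8_iff
    by (elim disjE; simp add: chord_def rim_pt_def hub_pt_def)
  moreover from this have "v = 0" "w = 0" using 1(1-4) by linarith+
  ultimately show ?thesis using 1 by (simp add: complex_eq_iff)
qed

lemma rims_meet: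
  assumes "i < j" "j < 8" "z \<in> closed_segment (rim_pt i) (rim_pt (Suc i mod 8))"
    "z \<in> closed_segment (rim_pt j) (rim_pt (Suc j mod 8))"
  shows "z \<in> rim_pt ` ({i, Suc i mod 8} \<inter> {j, Suc j mod 8})"
proof -
  obtain t where 1: "0 \<le> t" "t \<le> 1"
    "Re z = (1 - t) * Re (rim_pt i) + t * Re (rim_pt (Suc i mod 8))"
    "Im z = (1 - t) * Im (rim_pt i) + t * Im (rim_pt (Suc i mod 8))"
    using assms(3) by (auto simp: closed_segment_def)
  obtain t' where 2: "0 \<le> t'" "t' \<le> 1"
    "Re z = (1 - t') * Re (rim_pt j) + t' * Re (rim_pt (Suc j mod 8))"
    "Im z = (1 - t') * Im (rim_pt j) + t' * Im (rim_pt (Suc j mod 8))"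
    using assms(4) by (auto simp: closed_segment_def)
  have "i < 8" using assms by simp
  then have "j = Suc i mod 8 \<and> t = 1 \<or> i = Suc j mod 8 \<and> t = 0"
    using assms(1,2) 1 2 unfolding less_8_iff
    by (elim disjE; simp add: rim_pt_def)
  then show ?thesis using 1 by (auto simp: complex_eq_iff)
qed

lemma convex_cell: "convex (cell i)" by (simp add: cell_def)

text \<open>The affine map that sends the drawing of a strand into its cell.\<close>
definition place :: "nat \<Rightarrow> nat \<Rightarrow> complex \<Rightarrow> complex" where
  "place m i z = rim_pt i + ((Re z + 1) / (real m + 2)) *\<^sub>R (hub_pt (chord i) - rim_pt i)
     + ((Im z + 1) / (4 * (real m + 2))) *\<^sub>R Complex 0 (1/5)"

lemma place_closed_segment:
  "closed_segment (place m i a) (place m i b) = place m i ` closed_segment a b"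
proof -
  define M where "M z = (Re z / (real m + 2)) *\<^sub>R (hub_pt (chord i) - rim_pt i)
     + (Im z / (4 * (real m + 2))) *\<^sub>R Complex 0 (1/5)" for z
  have "linear M"
    by (rule linearI) (simp_all add: M_def add_divide_distrib scaleR_add_left algebra_simps scaleR_add_right)
  define c where "c = place m i 0"
  have "place m i = (\<lambda>z. c + M z)"
    by (simp add: fun_eq_iff c_def place_def M_def add_divide_distrib scaleR_add_left)
  then show ?thesis
    using closed_segment_translation[of c "M a" "M b"] closed_segment_linear_image[OF \<open>linear M\<close>, of a b]
    by (simp add: image_image)
qed

text \<open>The second summand of \<open>place\<close> is vertical, so injectivity rests on the fact
  that no segment from a rim point to its hub is vertical.\<close>

lemma place_inj:
  assumes "i < 8" "place m i a = place m i b"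
  shows "a = b"
proof -
  have ne: "Re (hub_pt (chord i)) \<noteq> Re (rim_pt i)"
    using assms(1) unfolding less_8_iff by (elim disjE; simp add: chord_def rim_pt_def hub_pt_def)
  have m: "real m + 2 \<noteq> 0" by simp
  have "(Re a + 1) / (real m + 2) * (Re (hub_pt (chord i)) - Re (rim_pt i))
      = (Re b + 1) / (real m + 2) * (Re (hub_pt (chord i)) - Re (rim_pt i))"
    using arg_cong[OF assms(2), of Re] by (simp add: place_def)
  then have re: "Re a = Re b" using ne m by simp
  have "(Im a + 1) / (4 * (real m + 2)) = (Im b + 1) / (4 * (real m + 2))"
    using arg_cong[OF assms(2), of Im] re by (simp add: place_def)
  then have "Im a = Im b" using m by simp
  then show ?thesis using re by (simp add: complex_eq_iff)
qed

text \<open>With \<alpha> measured along the base and \<beta> upwards, the cell is given by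
  \<open>0 \<le> \<beta>\<close>, \<open>\<beta> \<le> \<alpha>\<close> and
  \<open>\<beta> \<le> 1 - \<alpha>\<close>. The factor 4 in \<open>place\<close> is the largest
  value of \<open>Im z + 1\<close> on a strand: it keeps \<beta> at most \<open>1 / (m + 2)\<close>,
  and strand vertices are at least that far from both ends.\<close>

lemma place_in_cell:
  assumes "0 \<le> Im z + 1" "Im z + 1 \<le> 4 * (Re z + 1)" "Im z + 1 \<le> 4 * (real m + 1 - Re z)"
  shows "place m i z \<in> cell i"
proof -
  define \<alpha> \<beta> where "\<alpha> = (Re z + 1) / (real m + 2)" and "\<beta> = (Im z + 1) / (4 * (real m + 2))"
  have "\<beta> \<ge> 0" using assms by (simp add: \<beta>_def)
  moreover have "\<beta> \<le> 4 * (Re z + 1) / (4 * (real m + 2))"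
    using assms(2) unfolding \<beta>_def by (intro divide_right_mono) auto
  then have "\<beta> \<le> \<alpha>" unfolding \<alpha>_def by (metis mult_divide_mult_cancel_left zero_neq_numeral)
  moreover have "\<beta> \<le> 4 * (real m + 1 - Re z) / (4 * (real m + 2))"
    using assms(3) unfolding \<beta>_def by (intro divide_right_mono) auto
  then have "\<beta> \<le> 1 - \<alpha>" by (simp add: \<alpha>_def field_simps)
  moreover have "place m i z = (1 - \<alpha> - \<beta>) *\<^sub>R rim_pt i + (\<alpha> - \<beta>) *\<^sub>R hub_pt (chord i)
      + (2 * \<beta>) *\<^sub>R ((rim_pt i + hub_pt (chord i)) / 2 + Complex 0 (1/10))"
    unfolding place_def \<alpha>_def[symmetric] \<beta>_def[symmetric] by (simp add: complex_eq_iff algebra_simps)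
  ultimately show ?thesis unfolding cell_def convex_hull_3
    by (intro CollectI exI[of _ "1 - \<alpha> - \<beta>"] exI[of _ "\<alpha> - \<beta>"] exI[of _ "2 * \<beta>"]) simp
qed

fun pos :: "nat \<Rightarrow> vert \<Rightarrow> complex" where
  "pos m (X i) = rim_pt i"
| "pos m (Z k) = hub_pt k"
| "pos m (H i s) = place m i (loc m (H i s))"

lemma strand_verts:
  assumes "(u, v) \<in> strand m i" "m \<ge> 5"
  shows "{u, v} \<subseteq> {X i, Z (chord i)} \<union> H i ` {..m}"
  using assms by (auto elim!: strand.cases)

lemma pos_eq_place:
  assumes "w \<in> {X i, Z (chord i)} \<union> H i ` {..m}"
  shows "pos m w = place m i (loc m w)"
proof -
  have "(2 + real m) / (real m + 2) = 1" using divide_self[of "real m + 2"] by (simp add: add.commute)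
  moreover have "place m i (loc m (Z k)) = rim_pt i + ((2 + real m) / (real m + 2)) *\<^sub>R (hub_pt (chord i) - rim_pt i)" for k
    by (simp add: place_def)
  ultimately have "place m i (loc m (Z k)) = hub_pt (chord i)" for k
    by (simp only: scaleR_one add_diff_cancel_left') simp
  then show ?thesis using assms by (auto simp: place_def)
qed

lemma pos_in_cell:
  assumes "m \<ge> 5" "odd m" "w \<in> {X i, Z (chord i)} \<union> H i ` {..m}"
  shows "pos m w \<in> cell i"
  unfolding pos_eq_place[OF assms(3)]
proof (cases w)
  case (H j s)
  then have "real s \<le> real m" "real s \<ge> 0" using assms(3) by auto
  then show "place m i (loc m w) \<in> cell i"
    using H height_bounds[OF assms(1,2), of s] by (intro place_in_cell) auto
qed (auto intro!: place_in_cell)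

lemma strand_in_cell:
  assumes "m \<ge> 5" "odd m" "(u, v) \<in> strand m i"
  shows "closed_segment (pos m u) (pos m v) \<subseteq> cell i"
  using strand_verts[OF assms(3,1)] pos_in_cell[OF assms(1,2), of u i] pos_in_cell[OF assms(1,2), of v i]
  by (intro closed_segment_subset convex_cell) auto

lemma strand_segment:
  assumes "m \<ge> 5" "(u, v) \<in> strand m i"
  shows "closed_segment (pos m u) (pos m v) = place m i ` closed_segment (loc m u) (loc m v)"
  using strand_verts[OF assms(2,1)] pos_eq_place[of u i m] pos_eq_place[of v i m]
  by (simp add: place_closed_segment)

text \<open>\<open>cells_meet\<close> and \<open>rim_meets_cell\<close> yield common points, while
  planarity asks for common vertices. In the local drawing \<open>X i\<close> is strictly leftmost
  and the middle vertex strictly rightmost, so an edge through one of them ends there.\<close>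

lemma strand_end:
  assumes "m \<ge> 5" "i < 8" and uv: "(u, v) \<in> strand m i" and w: "w = X i \<or> w = Z (chord i)"
    and "pos m w \<in> closed_segment (pos m u) (pos m v)"
  shows "w \<in> {u, v}"
proof (rule ccontr)
  assume nw: "w \<notin> {u, v}"
  have "loc m w \<in> closed_segment (loc m u) (loc m v)"
  proof -
    obtain y where "y \<in> closed_segment (loc m u) (loc m v)" "pos m w = place m i y"
      using assms(5) unfolding strand_segment[OF assms(1) uv] by auto
    moreover have "pos m w = place m i (loc m w)" using pos_eq_place[of w i m] w by blast
    ultimately show ?thesis using place_inj[OF \<open>i < 8\<close>, of m "loc m w" y] by simp
  qed
  then have re: "Re (loc m w) \<in> closed_segment (Re (loc m u)) (Re (loc m v))"
    using closed_segment_linear_image[OF linear_coords(1)] by blast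
  from w show False
  proof
    assume "w = X i"
    then have "Re (loc m x) > Re (loc m w)" if "x \<in> {u, v}" for x
      using nw strand_verts[OF uv assms(1)] that by auto
    from this[of u] this[of v] show False using re by (auto simp: closed_segment_eq_real_ivl split: if_splits)
  next
    assume "w = Z (chord i)"
    then have "Re (loc m x) < Re (loc m w)" if "x \<in> {u, v}" for x
      using nw strand_verts[OF uv assms(1)] that by auto
    from this[of u] this[of v] show False using re by (auto simp: closed_segment_eq_real_ivl split: if_splits)
  qed
qed

lemma base_arcs_rim_or_strand:
  assumes "(u, v) \<in> base_arcs m"
  obtains i where "i < 8" "u = X i" "v = X (Suc i mod 8)" | i where "i < 8" "(u, v) \<in> strand m i"
  using assms
proof cases
  case (zigzag i s)
  then show thesis using that(2)[of i] s_step[of s "Suc s" m i] by simp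
next
  case (side i s)
  then show thesis using that(2)[of i] s_step[of s "s + 2" m i] by simp
next
  case (top i)
  then show thesis using that(2)[of i] s_top[of i m] by simp
next
  case (bottom i)
  then show thesis using that(2)[of i] s_bottom[of i m] by simp
qed (auto intro: that strand.intros)

lemma planar_chord_graph:
  assumes m: "m \<ge> 5" "odd m"
  shows "planar (chord_graph m)"
proof (rule planar_straight[where B = "base_arcs m" and p = "pos m"])
  show "pair_graph (chord_graph m)" by (rule pair_graph_chord_graph[OF m(1)])
  show "parcs (chord_graph m) = base_arcs m \<union> (base_arcs m)\<inverse>" by (simp add: chord_graph_def)
  show "card {w. (v, w) \<in> parcs (chord_graph m)} \<ge> 3" if "v \<in> pverts (chord_graph m)" for v
    using parcs_chord_graph[OF m(1) that] card_nbhd[OF m(1) that] by simp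
next
  have strands: "closed_segment (pos m u) (pos m v) \<inter> closed_segment (pos m u') (pos m v') \<subseteq> pos m ` ({u, v} \<inter> {u', v'})"
    if e: "i < 8" "(u, v) \<in> strand m i" and f: "j < 8" "(u', v') \<in> strand m j" and ij: "i < j" for i j u v u' v'
  proof
    fix x assume x: "x \<in> closed_segment (pos m u) (pos m v) \<inter> closed_segment (pos m u') (pos m v')"
    then have "x \<in> cell i" "x \<in> cell j" using strand_in_cell[OF m e(2)] strand_in_cell[OF m f(2)] by auto
    then have c: "chord i = chord j" "x = hub_pt (chord i)" using cells_meet[OF ij f(1), of x] by blast+
    then have "Z (chord i) \<in> {u, v}" "Z (chord j) \<in> {u', v'}"
      using strand_end[OF m(1) e, of "Z (chord i)"] strand_end[OF m(1) f, of "Z (chord j)"] x by auto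
    then have "Z (chord i) \<in> {u, v} \<inter> {u', v'}" using c by auto
    moreover have "x = pos m (Z (chord i))" using c by simp
    ultimately show "x \<in> pos m ` ({u, v} \<inter> {u', v'})" by blast
  qed
  have rim_strand: "closed_segment (rim_pt i) (rim_pt (Suc i mod 8)) \<inter> closed_segment (pos m u') (pos m v')
      \<subseteq> pos m ` ({X i, X (Suc i mod 8)} \<inter> {u', v'})"
    if i: "i < 8" and f: "j < 8" "(u', v') \<in> strand m j" for i j u' v'
  proof
    fix x assume x: "x \<in> closed_segment (rim_pt i) (rim_pt (Suc i mod 8)) \<inter> closed_segment (pos m u') (pos m v')"
    then have "x \<in> cell j" using strand_in_cell[OF m f(2)] by auto
    then have j: "j = i \<or> j = Suc i mod 8" "x = rim_pt j" using rim_meets_cell[OF i f(1)] x by auto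
    then have "X j \<in> {u', v'}" using strand_end[OF m(1) f, of "X j"] x by auto
    then have "X j \<in> {X i, X (Suc i mod 8)} \<inter> {u', v'}" using j by auto
    moreover have "x = pos m (X j)" using j by simp
    ultimately show "x \<in> pos m ` ({X i, X (Suc i mod 8)} \<inter> {u', v'})" by blast
  qed
  have rims: "closed_segment (rim_pt i) (rim_pt (Suc i mod 8)) \<inter> closed_segment (rim_pt j) (rim_pt (Suc j mod 8))
      \<subseteq> pos m ` ({X i, X (Suc i mod 8)} \<inter> {X j, X (Suc j mod 8)})" if "i < j" "j < 8" for i j
  proof
    note ij = that
    fix x assume "x \<in> closed_segment (rim_pt i) (rim_pt (Suc i mod 8)) \<inter> closed_segment (rim_pt j) (rim_pt (Suc j mod 8))"
    then obtain k where "k \<in> {i, Suc i mod 8} \<inter> {j, Suc j mod 8}" "x = rim_pt k"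
      using rims_meet[OF ij, of x] by blast
    then have "X k \<in> {X i, X (Suc i mod 8)} \<inter> {X j, X (Suc j mod 8)}" "x = pos m (X k)" by auto
    then show "x \<in> pos m ` ({X i, X (Suc i mod 8)} \<inter> {X j, X (Suc j mod 8)})" by blast
  qed
  fix u v u' v' assume e: "(u, v) \<in> base_arcs m" and f: "(u', v') \<in> base_arcs m" and ne: "{u, v} \<noteq> {u', v'}"
  show "closed_segment (pos m u) (pos m v) \<inter> closed_segment (pos m u') (pos m v') \<subseteq> pos m ` ({u, v} \<inter> {u', v'})"
    using e
  proof (cases rule: base_arcs_rim_or_strand)
    case i: (1 i)
    from f show ?thesis
    proof (cases rule: base_arcs_rim_or_strand)
      case j: (1 j)
      then have "i \<noteq> j" using i ne by auto
      then show ?thesis using rims[of i j] rims[of j i] i j by (cases i j rule: linorder_cases) (auto simp: Int_commute)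
    next
      case j: (2 j)
      then show ?thesis using rim_strand[OF i(1) j] i by simp
    qed
  next
    case i: (2 i)
    from f show ?thesis
    proof (cases rule: base_arcs_rim_or_strand)
      case j: (1 j)
      then show ?thesis using rim_strand[OF j(1) i] by (simp add: Int_commute)
    next
      case j: (2 j)
      show ?thesis
      proof (cases i j rule: linorder_cases)
        case less
        then show ?thesis using strands[OF i j] by simp
      next
        case greater
        then show ?thesis using strands[OF j i] by (simp add: Int_commute)
      next
        case equal
        have "(u, v) \<noteq> (u', v')" using ne by auto
        then have ap: "apart m (u, v) (u', v')" using strand_apart[OF m i(2)] j(2) equal by simp
        have j': "(u', v') \<in> strand m i" using j equal by simp
        \<comment> \<open>Within one link the intersection is computed in the local drawing; an
          injective map commutes with intersections.\<close>
        have "closed_segment (pos m u) (pos m v) \<inter> closed_segment (pos m u') (pos m v')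
          = place m i ` (closed_segment (loc m u) (loc m v) \<inter> closed_segment (loc m u') (loc m v'))"
          unfolding strand_segment[OF m(1) i(2)] strand_segment[OF m(1) j']
          using place_inj[OF i(1)] by (auto simp: image_iff)
        also have "\<dots> \<subseteq> place m i ` loc m ` ({u, v} \<inter> {u', v'})" using ap by (intro image_mono) (simp add: apart_def)
        also have "\<dots> = pos m ` ({u, v} \<inter> {u', v'})"
          unfolding image_image
        proof (rule image_cong[OF refl])
          fix w assume "w \<in> {u, v} \<inter> {u', v'}"
          then have "w \<in> {X i, Z (chord i)} \<union> H i ` {..m}" using strand_verts[OF i(2) m(1)] by blast
          then show "place m i (loc m w) = pos m w" by (rule pos_eq_place[symmetric])
        qed
        finally show ?thesis .
      qed
    qed
  qed
qed

section \<open>Biconnectivity\<close>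

definition hamiltonian_cycle :: "'a pair_pre_digraph \<Rightarrow> 'a list \<Rightarrow> bool" where
  "hamiltonian_cycle G xs \<longleftrightarrow> length xs \<ge> 3 \<and> distinct xs \<and> set xs = pverts G \<and>
     successively (\<lambda>u v. (u, v) \<in> parcs G) xs \<and> (last xs, hd xs) \<in> parcs G"

lemma connected_if_spanning_path:
  fixes K :: "('a, 'b) pre_digraph"
  assumes "xs \<noteq> []" "set xs = verts K" "successively (\<lambda>u v. (u, v) \<in> arcs_ends K) xs"
  shows "Digraph_Component.connected K"
proof -
  let ?R = "rtrancl_on (verts K) ((arcs_ends K)\<^sup>s)"
  have reach: "\<forall>v \<in> set (x # ys). (x, v) \<in> ?R"
    if "successively (\<lambda>u v. (u, v) \<in> arcs_ends K) (x # ys)" "set (x # ys) \<subseteq> verts K" for x ys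
    using that
  proof (induction ys arbitrary: x)
    case (Cons y ys)
    then have "(x, y) \<in> (arcs_ends K)\<^sup>s" "x \<in> verts K" "\<forall>v \<in> set (y # ys). (y, v) \<in> ?R"
      by (auto simp: symcl_def)
    then show ?case by (auto intro: converse_rtrancl_on_into_rtrancl_on)
  qed auto
  obtain x ys where xs: "xs = x # ys" using assms(1) by (cases xs) auto
  have "sym ((arcs_ends K)\<^sup>s)" by (auto simp: sym_def symcl_def)
  then have "sym ?R" by (rule rtrancl_on_sym)
  then have "(u, v) \<in> ?R" if "u \<in> verts K" "v \<in> verts K" for u v
    using reach[of x ys] assms that unfolding xs by (metis order_refl rtrancl_on_trans symD)
  moreover have "verts K \<noteq> {}" using assms(1,2) by auto
  ultimately show ?thesis by (simp add: connected_conv)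
qed

text \<open>Without \<open>v\<close> the cycle is a path through all other vertices: the part after
  \<open>v\<close> followed by the part before it, joined by the closing edge.\<close>

lemma biconnected_if_hamiltonian_cycle:
  assumes "hamiltonian_cycle G xs"
  shows "biconnected G"
proof -
  let ?E = "\<lambda>u v. (u, v) \<in> parcs G"
  have xs: "length xs \<ge> 3" "distinct xs" "set xs = pverts G" "successively ?E xs" "?E (last xs) (hd xs)"
    using assms by (auto simp: hamiltonian_cycle_def)
  have "card (pverts G) \<ge> 3" using xs distinct_card[of xs] by simp
  moreover have "Digraph_Component.connected (with_proj G)"
    by (rule connected_if_spanning_path[of xs]) (use xs in auto)
  moreover have "Digraph_Component.connected (pre_digraph.del_vert (with_proj G) v)" if "v \<in> pverts G" for v
  proof -
    have "v \<in> set xs" using that xs by simp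
    then obtain as bs where ab: "xs = as @ v # bs" by (meson split_list)
    have "arcs_ends (pre_digraph.del_vert (with_proj G) v) = {(a, b) \<in> parcs G. a \<noteq> v \<and> b \<noteq> v}"
      by (auto simp: arcs_ends_conv pre_digraph.del_vert_def)
    moreover have "successively (\<lambda>a b. (a, b) \<in> {(a, b) \<in> parcs G. a \<noteq> v \<and> b \<noteq> v}) (bs @ as)"
    proof -
      have "successively ?E (bs @ as)"
        using xs(4,5) unfolding ab
        by (cases "as = []"; cases "bs = []") (auto simp: successively_append_iff successively_Cons)
      then show ?thesis
      proof (rule successively_mono)
        fix a b assume "a \<in> set (bs @ as)" "b \<in> set (bs @ as)" "?E a b"
        then show "(a, b) \<in> {(a, b) \<in> parcs G. a \<noteq> v \<and> b \<noteq> v}" using xs(2) ab by auto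
      qed
    qed
    moreover have "verts (pre_digraph.del_vert (with_proj G) v) = set (bs @ as)"
      using xs(2,3) unfolding ab by (auto simp: pre_digraph.del_vert_def)
    moreover have "bs @ as \<noteq> []" using xs(1) ab by auto
    ultimately show ?thesis by (intro connected_if_spanning_path[of "bs @ as"]) auto
  qed
  ultimately show ?thesis by (simp add: biconnected_def)
qed

section \<open>A Hamiltonian cycle\<close>

definition chord_path :: "nat \<Rightarrow> nat \<Rightarrow> nat \<Rightarrow> vert list" where
  "chord_path m a b = X a # map (H a) [0..<Suc m] @ Z (chord a) # rev (map (H b) [0..<Suc m]) @ [X b]"

lemma chord_path_props:
  "set (chord_path m a b) = {X a, X b, Z (chord a)} \<union> H a ` {..m} \<union> H b ` {..m}"
  "length (chord_path m a b) = 3 + 2 * (m + 1)"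
  "hd (chord_path m a b) = X a" "last (chord_path m a b) = X b" "chord_path m a b \<noteq> []"
proof -
  have "set [0..<Suc m] = {..m}" by auto
  then show "set (chord_path m a b) = {X a, X b, Z (chord a)} \<union> H a ` {..m} \<union> H b ` {..m}"
    unfolding chord_path_def by (simp del: upt_Suc) blast
qed (simp_all add: chord_path_def)

lemma successively_chord_path:
  assumes "a < 8" "b < 8" "chord a = chord b"
  shows "successively (\<lambda>u v. (u, v) \<in> parcs (chord_graph m)) (chord_path m a b)"
proof -
  let ?E = "\<lambda>u v. (u, v) \<in> parcs (chord_graph m)"
  have S: "successively ?E (map (H i) [0..<Suc n]) \<and> successively ?E (rev (map (H i) [0..<Suc n]))"
    if "i < 8" "n \<le> m" for i n
    using that(2)
  proof (induction n)
    case (Suc n)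
    then have "?E (H i n) (H i (Suc n))" "?E (H i (Suc n)) (H i n)"
      using zigzag[OF that(1), of n m] by (auto simp: parcs_iff)
    then show ?case using Suc by (auto simp: successively_append_iff successively_Cons)
  qed auto
  have ends: "hd (map (H i) [0..<Suc m]) = H i 0" "last (map (H i) [0..<Suc m]) = H i m" for i
    by (simp_all add: hd_map last_map hd_append del: upt_Suc)
  show ?thesis
    using S[OF assms(1) order_refl] S[OF assms(2) order_refl] assms
      enter[OF assms(1), of m] leave[OF assms(1), of m] enter[OF assms(2), of m] leave[OF assms(2), of m] ends
    unfolding chord_path_def
    by (simp add: successively_append_iff successively_Cons parcs_iff hd_rev last_rev hd_append del: upt_Suc)
qed

text \<open>Each chord is traversed through both of its strands. The chords are ordered and directed
  so that the ends 4 and 3, 6 and 5, 0 and 7, 2 and 1 of successive chords are adjacent on the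
  rim.\<close>

lemma hamiltonian_chord_graph:
  shows "\<exists>xs. hamiltonian_cycle (chord_graph m) xs"
proof -
  let ?E = "\<lambda>u v. (u, v) \<in> parcs (chord_graph m)"
  let ?xs = "chord_path m 1 4 @ chord_path m 3 6 @ chord_path m 5 0 @ chord_path m 7 2"
  have "(X 1, X 2) \<in> base_arcs m" using rim[of 1 m] by (simp add: numeral_2_eq_2)
  then have rims: "?E (X 4) (X 3)" "?E (X 6) (X 5)" "?E (X 0) (X 7)" "?E (X 2) (X 1)"
    using rim[of 3 m] rim[of 5 m] rim[of 7 m] by (simp_all add: parcs_iff)
  have set: "set ?xs = pverts (chord_graph m)"
  proof
    have "set (chord_path m a b) \<subseteq> pverts (chord_graph m)" if "a < 8" "b < 8" for a b
      unfolding chord_path_props(1) using that chord_less[of a] by auto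
    then show "set ?xs \<subseteq> pverts (chord_graph m)" by simp
    show "pverts (chord_graph m) \<subseteq> set ?xs"
    proof
      fix u assume u: "u \<in> pverts (chord_graph m)"
      show "u \<in> set ?xs"
      proof (cases u)
        case (X i)
        then have "i < 8" using u by simp
        then show ?thesis unfolding X less_8_iff set_append chord_path_props(1) by (elim disjE) simp_all
      next
        case (Z k)
        then have "k < 4" using u by simp
        then show ?thesis unfolding Z less_4_iff set_append chord_path_props(1)
          by (elim disjE) (simp_all add: chord_def)
      next
        case (H i s)
        then have i: "i < 8" and s: "s \<le> m" using u by auto
        from i show ?thesis
          unfolding H less_8_iff set_append chord_path_props(1) by (elim disjE) (simp_all add: s)
      qed
    qed
  qed
  \<comment> \<open>The list covers all vertices, and its length
    \<open>4 * (3 + 2 * (m + 1))\<close> equals their number.\<close>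
  moreover have "distinct ?xs"
    by (rule card_distinct, unfold set card_chord_graph) (simp add: chord_path_props(2))
  moreover have "successively ?E ?xs"
    using rims successively_chord_path[of 1 4 m] successively_chord_path[of 3 6 m]
      successively_chord_path[of 5 0 m] successively_chord_path[of 7 2 m]
    by (simp add: successively_append_iff chord_path_props chord_def hd_append)
  moreover have "?E (last ?xs) (hd ?xs)" using rims by (simp add: chord_path_props hd_append last_append)
  moreover have "length ?xs \<ge> 3" by (simp add: chord_path_props(2))
  ultimately have "hamiltonian_cycle (chord_graph m) ?xs"
    using set unfolding hamiltonian_cycle_def by (intro conjI)
  then show ?thesis ..
qed

section \<open>Graphs on natural numbers\<close>

definition map_graph :: "('a \<Rightarrow> 'b) \<Rightarrow> 'a pair_pre_digraph \<Rightarrow> 'b pair_pre_digraph" where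
  "map_graph h G = \<lparr>pverts = h ` pverts G, parcs = map_prod h h ` parcs G\<rparr>"

lemma map_graph_simps [simp]:
  "pverts (map_graph h G) = h ` pverts G" "parcs (map_graph h G) = map_prod h h ` parcs G"
  by (simp_all add: map_graph_def)

lemma uedges_conv_image: "uedges G = (\<lambda>(u, v). {u, v}) ` parcs G"
  by (auto simp: uedges_def)

lemma uedges_map_graph: "uedges (map_graph h G) = (`) h ` uedges G"
  by (simp add: uedges_conv_image image_image case_prod_unfold)

context
  fixes h :: "'a \<Rightarrow> 'b" assumes h: "inj h"
begin

lemma inj_on_h: "inj_on h S"
  using h by (rule inj_on_subset) simp

lemma h_eq: "h x = h y \<longleftrightarrow> x = y"
  using h by (rule inj_eq)

lemma pair_graph_map_graph:
  assumes "pair_graph G"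
  shows "pair_graph (map_graph h G)"
proof -
  interpret pair_graph G by fact
  have "symmetric (with_proj (map_graph h G))"
  proof -
    have "(h v, h u) \<in> map_prod h h ` parcs G" if "(u, v) \<in> parcs G" for u v
      using arcs_symmetric[OF that] by (rule rev_image_eqI) simp
    then show ?thesis by (auto simp: symmetric_def sym_def)
  qed
  then show ?thesis
    by unfold_locales
      (auto simp: pair_finite_verts pair_finite_arcs wellformed' h_eq dest: no_loops')
qed

lemma regular_map_graph:
  assumes "regular k G"
  shows "regular k (map_graph h G)"
  unfolding regular_def
proof
  fix v assume "v \<in> pverts (map_graph h G)"
  then obtain u where u: "u \<in> pverts G" "v = h u" by auto
  have "out_arcs (with_proj (map_graph h G)) v = map_prod h h ` out_arcs (with_proj G) u"
    by (auto simp: out_arcs_def u h_eq intro: rev_image_eqI)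
  moreover have "inj_on (map_prod h h) S" for S by (auto simp: inj_on_def h_eq)
  ultimately show "out_degree (with_proj (map_graph h G)) v = k"
    using assms u by (simp add: out_degree_def regular_def card_image)
qed

lemma hamiltonian_cycle_map_graph:
  assumes "hamiltonian_cycle G xs"
  shows "hamiltonian_cycle (map_graph h G) (map h xs)"
proof -
  have "xs \<noteq> []" using assms by (auto simp: hamiltonian_cycle_def)
  moreover have "successively (\<lambda>u v. (u, v) \<in> parcs (map_graph h G)) (map h xs)"
    unfolding successively_map
    by (rule successively_mono[of "\<lambda>u v. (u, v) \<in> parcs G"]) (use assms in \<open>auto simp: hamiltonian_cycle_def\<close>)
  ultimately show ?thesis
    using assms inj_on_h by (auto simp: hamiltonian_cycle_def distinct_map hd_map last_map)
qed

lemma planar_map_graph: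
  assumes "planar G"
  shows "planar (map_graph h G)"
proof -
  obtain p \<gamma> where "plane_drawing G p \<gamma>" using assms by (auto simp: planar_def)
  then have p: "inj_on p (pverts G)"
    "\<And>e. e \<in> uedges G \<Longrightarrow> arc (\<gamma> e) \<and> {pathstart (\<gamma> e), pathfinish (\<gamma> e)} = p ` e \<and>
        path_image (\<gamma> e) \<inter> p ` pverts G = p ` e"
    "\<And>e f. e \<in> uedges G \<Longrightarrow> f \<in> uedges G \<Longrightarrow> e \<noteq> f \<Longrightarrow> path_image (\<gamma> e) \<inter> path_image (\<gamma> f) = p ` (e \<inter> f)"
    by (auto simp: plane_drawing_def)
  define p' where "p' = p \<circ> inv h"
  define \<gamma>' where "\<gamma>' e = \<gamma> (inv h ` e)" for e
  have im: "p' ` h ` S = p ` S" and ih: "inv h ` h ` S = S" for S using h by (auto simp: p'_def image_image)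
  have "plane_drawing (map_graph h G) p' \<gamma>'"
    unfolding plane_drawing_def uedges_map_graph
  proof (intro conjI ballI impI)
    show "inj_on p' (pverts (map_graph h G))"
      using p(1) h by (auto simp: inj_on_def p'_def)
  next
    fix e assume "e \<in> (`) h ` uedges G"
    then obtain e' where "e' \<in> uedges G" "e = h ` e'" by auto
    then show "arc (\<gamma>' e)" "{pathstart (\<gamma>' e), pathfinish (\<gamma>' e)} = p' ` e"
      "path_image (\<gamma>' e) \<inter> p' ` pverts (map_graph h G) = p' ` e"
      using p(2)[of e'] by (simp_all add: \<gamma>'_def im ih)
  next
    fix e f assume "e \<in> (`) h ` uedges G" "f \<in> (`) h ` uedges G" "e \<noteq> f"
    then obtain e' f' where e: "e' \<in> uedges G" "e = h ` e'" "f' \<in> uedges G" "f = h ` f'" "e' \<noteq> f'" by auto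
    then show "path_image (\<gamma>' e) \<inter> path_image (\<gamma>' f) = p' ` (e \<inter> f)"
      using p(3)[of e' f'] h by (simp add: \<gamma>'_def ih im flip: image_Int)
  qed
  then show ?thesis by (auto simp: planar_def)
qed

lemma circle_realizable_map_graph:
  assumes "circle_realizable (map_graph h G)"
  shows "circle_realizable G"
proof -
  obtain \<C> f g where C: "circle_system \<C>" and f: "bij_betw f (h ` pverts G) (system_points \<C>)"
    and g: "bij_betw g ((`) h ` uedges G) (system_arcs \<C>)"
    and ends: "\<forall>e \<in> (`) h ` uedges G. arc_ends (g e) = f ` e"
    using assms by (auto simp: circle_realizable_def realizes_def uedges_map_graph)
  have "bij_betw (f \<circ> h) (pverts G) (system_points \<C>)"
    using inj_on_h by (intro bij_betw_trans[OF _ f]) (auto simp: bij_betw_def)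
  moreover have "bij_betw (g \<circ> (`) h) (uedges G) (system_arcs \<C>)"
    using h by (intro bij_betw_trans[OF _ g]) (auto simp: bij_betw_def inj_on_def inj_image_eq_iff)
  moreover have "\<forall>e \<in> uedges G. arc_ends ((g \<circ> (`) h) e) = (f \<circ> h) ` e"
    using ends by (auto simp: image_comp)
  ultimately show ?thesis using C unfolding circle_realizable_def realizes_def by blast
qed

end

instance vert :: countable
  by countable_datatype

lemma digraph_iso_card:
  assumes "digraph_iso (with_proj G) (with_proj G')"
  shows "card (pverts G) = card (pverts G')"
proof -
  obtain f where "pre_digraph.digraph_isomorphism (with_proj G) f" "with_proj G' = app_iso f (with_proj G)"
    using assms by (auto simp: digraph_iso_def)
  then have "inj_on (iso_verts f) (pverts G)" "pverts G' = iso_verts f ` pverts G"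
    by (auto simp: pre_digraph.digraph_isomorphism_def app_iso_def with_proj_def)
  then show ?thesis by (simp add: card_image)
qed

theorem theorem6:
  shows "\<exists>\<G> :: nat pair_pre_digraph set.
    infinite \<G> \<and>
    pairwise (\<lambda>G H. \<not> digraph_iso (with_proj G) (with_proj H)) \<G> \<and>
    (\<forall>G \<in> \<G>. pair_graph G \<and> biconnected G \<and> regular 4 G \<and> planar G \<and>
       \<not> circle_realizable G)"
proof -
  \<comment> \<open>\<open>2 * n + 5\<close> runs through the odd numbers from 5 on: odd for the
    drawing of the strands, and with a number of vertices that grows with \<open>n\<close>, which
    excludes isomorphisms.\<close>
  define \<Gamma> :: "nat \<Rightarrow> nat pair_pre_digraph" where "\<Gamma> n = map_graph to_nat (chord_graph (2 * n + 5))" for n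
  have inj: "inj (to_nat :: vert \<Rightarrow> nat)" by simp
  have card: "card (pverts (\<Gamma> n)) = 12 + 8 * (2 * n + 6)" for n
    by (simp add: \<Gamma>_def card_image[OF inj_on_h[OF inj]] card_chord_graph)
  then have "inj \<Gamma>" by (auto simp: inj_def dest: arg_cong[where f = "\<lambda>G. card (pverts G)"])
  then have "infinite (range \<Gamma>)" by (rule range_inj_infinite)
  moreover have "pairwise (\<lambda>G H. \<not> digraph_iso (with_proj G) (with_proj H)) (range \<Gamma>)"
  proof (rule pairwise_imageI)
    fix n k :: nat assume "n \<noteq> k"
    then show "\<not> digraph_iso (with_proj (\<Gamma> n)) (with_proj (\<Gamma> k))"
      using digraph_iso_card[of "\<Gamma> n" "\<Gamma> k"] card by auto
  qed
  moreover have "pair_graph (\<Gamma> n) \<and> biconnected (\<Gamma> n) \<and> regular 4 (\<Gamma> n) \<and> planar (\<Gamma> n) \<and>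
      \<not> circle_realizable (\<Gamma> n)" for n
  proof -
    let ?m = "2 * n + 5"
    have m: "?m \<ge> 5" "odd ?m" by auto
    have "\<not> circle_realizable (\<Gamma> n)"
      using circle_realizable_map_graph[OF inj] not_circle_realizable_chord_graph[OF m(1)]
      unfolding \<Gamma>_def by blast
    moreover obtain xs where "hamiltonian_cycle (chord_graph ?m) xs" using hamiltonian_chord_graph by blast
    then have "biconnected (\<Gamma> n)"
      unfolding \<Gamma>_def by (rule biconnected_if_hamiltonian_cycle[OF hamiltonian_cycle_map_graph[OF inj]])
    ultimately show ?thesis
      using pair_graph_map_graph[OF inj pair_graph_chord_graph[OF m(1)]]
        regular_map_graph[OF inj regular_chord_graph[OF m(1)]]
        planar_map_graph[OF inj planar_chord_graph[OF m]]
      by (simp add: \<Gamma>_def)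
  qed
  ultimately show ?thesis by (intro exI[of _ "range \<Gamma>"]) blast
qed

end
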